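(* Let $\mathbb{T}$ be a time scale with $\sup\mathbb{T}=\infty$, let $s\in\mathbb{T}$, and let $f:[s,\infty)_{\mathbb{T}}\to\mathbb{C}$ be locally $\Delta$-integrable. Assume that there exist an increasing divergent sequence $\{\varsigma_k\}_{k\in\mathbb{N}_0}\subset[0,\infty)$ and a constant $\alpha\in\mathbb{C}$ with $1+\alpha\mu(t)>0$ for all $t\in[s,\infty)_{\mathbb{T}}$ such that, for all $n,k\in\mathbb{N}_0$, the Laplace transform of $f\,\mathrm{e}_{\ominus(n\odot\varsigma_k)}(\sigma(\cdot),s)$ at $\alpha$ exists and vanishes, i.e. $$\mathcal{L}\{f\,\mathrm{e}_{\ominus(n\odot\varsigma_k)}(\sigma(\cdot),s)\}(\alpha)=\int_s^\infty f(\eta)\,\mathrm{e}_{\ominus(n\odot\varsigma_k)}(\sigma(\eta),s)\,\mathrm{e}_{\ominus\alpha}(\sigma(\eta),s)\,\Delta\eta=0 .$$ Then $f$ is a null function on $[s,\infty)_{\mathbb{T}}$, i.e. $\int_s^t f(\eta)\,\Delta\eta=0$ for all $t\in[s,\infty)_{\mathbb{T}}$.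
   Context: A time scale $\mathbb{T}$ is a nonempty closed subset of $\mathbb{R}$; $[s,\infty)_{\mathbb{T}}:=[s,\infty)\cap\mathbb{T}$. The forward jump operator is $\sigma(t):=\inf\big((t,\infty)\cap\mathbb{T}\big)$ and the graininess is $\mu(t):=\sigma(t)-t$. Integrals are $\Delta$-integrals on $\mathbb{T}$ (Lebesgue $\Delta$-integrals; for an rd-continuous integrand $f$, $\int_s^t f\,\Delta\eta=F(t)-F(s)$ with $F^\Delta=f$). Locally $\Delta$-integrable means $\Delta$-integrable over each compact interval of $[s,\infty)_{\mathbb{T}}$. The improper integral $\int_s^\infty$ is the limit of $\int_s^t$ as $t\to\infty$, $t\in\mathbb{T}$. A function $p$ is regressive if it is rd-continuous (continuous at right-dense points, with finite limits at left-dense points) and $1+\mu(t)p(t)\ne0$ for all $t$. For regressive $p$, the exponential $\mathrm{e}_p(\cdot,s)$ is the unique solution of $x^\Delta=p\,x$, $x(s)=1$; equivalently $\mathrm{e}_p(t,s)=\exp\big\{\int_s^t\xi_{\mu(\eta)}(p(\eta))\Delta\eta\big\}$, where $\xi_h(z)=\frac1h\operatorname{Log}(1+hz)$ for $h>0$ (principal logarithm) and $\xi_0(z)=z$. For regressive $p$, $\ominus p$ is the function $(\ominus p)(t):=-p(t)/(1+\mu(t)p(t))$. For $n\in\mathbb{N}_0$ and a constant $\varsigma\ge0$, $n\odot\varsigma$ is the function $(n\odot\varsigma)(t):=\frac{(1+\mu(t)\varsigma)^n-1}{\mu(t)}$ if $\mu(t)>0$ and $(n\odot\varsigma)(t):=n\varsigma$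 if $\mu(t)=0$; it satisfies $\mathrm{e}_{n\odot\varsigma}(t,s)=(\mathrm{e}_\varsigma(t,s))^n$. The Laplace transform is $\mathcal{L}\{f\}(z):=\int_s^\infty f(\eta)\,\mathrm{e}_{\ominus z}(\sigma(\eta),s)\,\Delta\eta$ for those $z$ for which the improper integral converges. *)

theory Defs
  imports "HOL-Analysis.Analysis"
begin

definition time_scale :: "real set \<Rightarrow> bool"
  where "time_scale T \<longleftrightarrow> T \<noteq> {} \<and> closed T"

text \<open>Only used for time scales without a largest element, so that the infimum is over a
  nonempty set.\<close>

definition forward_jump :: "real set \<Rightarrow> real \<Rightarrow> real"
  where "forward_jump T t = Inf ({t<..} \<inter> T)"

definition graininess :: "real set \<Rightarrow> real \<Rightarrow> real"
  where "graininess T t = forward_jump T t - t"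

text \<open>The Lebesgue \<open>\<Delta>\<close>-measure: the completed measure on \<open>T\<close> that extends the length function
  \<open>[a,b) \<inter> T \<mapsto> b - a\<close> (\<open>a, b \<in> T\<close>). For \<open>T\<close> closed and unbounded above these intervals have finite
  measure and countably many of them cover \<open>T\<close>, so the extension is unique; it exists by the lemma
  below (\<^const>\<open>extend_measure\<close> would be the null measure otherwise).\<close>

definition delta_measure :: "real set \<Rightarrow> real measure"
  where "delta_measure T =
    completion (extend_measure T {(a, b). a \<in> T \<and> b \<in> T \<and> a \<le> b}
      (\<lambda>(a, b). {a..<b} \<inter> T) (\<lambda>(a, b). ennreal (b - a)))"

lemma emeasure_delta_measure_Ico:
  assumes T: "time_scale T" "\<not> bdd_above T" and ab: "a \<in> T" "b \<in> T" "a \<le> b"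
  shows "emeasure (delta_measure T) ({a..<b} \<inter> T) = ennreal (b - a)"
proof -
  define I where "I = {(a, b). a \<in> T \<and> b \<in> T \<and> a \<le> b}"
  define G where "G = (\<lambda>(a, b). {a..<b::real} \<inter> T)"
  define M where "M = extend_measure T I G (\<lambda>(a, b). ennreal (b - a))"
  define D where "D = {x. \<exists>t\<in>T. t \<le> x}"
  define p where "p x = Sup (T \<inter> {..x})" for x
  have cl: "closed T" and ne: "T \<noteq> {}" using T by (auto simp: time_scale_def)
  have G: "G ` I \<subseteq> Pow T" by (auto simp: G_def)
  have setsM: "sets M = sets (sigma T (G ` I))"
    using G by (simp add: M_def sets_extend_measure)
  have D: "D \<in> sets lborel"
  proof (cases "bdd_below T")
    case True
    then have "D = {Inf T..}"
      using closed_contains_Inf[OF ne True cl] by (auto simp: D_def intro: cInf_lower2)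
    then show ?thesis by simp
  next
    case False
    then have "D = UNIV"
      by (auto simp: D_def bdd_below_def) (meson nle_le)
    then show ?thesis by simp
  qed
  have p: "p x \<in> T" "p x \<le> x" if "x \<in> D" for x
  proof -
    have "Sup (T \<inter> {..x}) \<in> T \<inter> {..x}"
      using that cl by (intro closed_contains_Sup) (auto simp: D_def bdd_above_def)
    then show "p x \<in> T" "p x \<le> x" by (auto simp: p_def)
  qed
  have p_ge: "t \<le> p x" if "t \<in> T" "t \<le> x" for t x
    unfolding p_def using that by (intro cSup_upper) (auto simp: bdd_above_def)
  have vim: "p -` ({a..<b} \<inter> T) \<inter> D = {a..<b}" if "a \<in> T" "b \<in> T" for a b
  proof (intro set_eqI iffI)
    fix x assume "x \<in> p -` ({a..<b} \<inter> T) \<inter> D"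
    then show "x \<in> {a..<b}"
      using p[of x] p_ge[OF that(2), of x] by (cases "b \<le> x") auto
  next
    fix x assume x: "x \<in> {a..<b}"
    then have "x \<in> D" using that by (auto simp: D_def)
    then show "x \<in> p -` ({a..<b} \<inter> T) \<inter> D"
      using p[of x] p_ge[OF that(1), of x] x by auto
  qed
  let ?N = "restrict_space lborel D"
  have meas: "p \<in> measurable ?N (sigma T (G ` I))"
  proof (rule measurable_measure_of)
    show "G ` I \<subseteq> Pow T" by (rule G)
    show "p \<in> space ?N \<rightarrow> T" using p by (auto simp: space_restrict_space)
    fix Y assume "Y \<in> G ` I"
    then obtain a b where Y: "Y = {a..<b} \<inter> T" "a \<in> T" "b \<in> T" by (auto simp: G_def I_def)
    then have "p -` Y \<inter> D = {a..<b}" using vim by simp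
    moreover have "{a..<b} \<subseteq> D" using Y by (auto simp: D_def)
    ultimately show "p -` Y \<inter> space ?N \<in> sets ?N"
      using D by (auto simp: space_restrict_space sets_restrict_space_iff)
  qed
  let ?P = "distr ?N (sigma T (G ` I)) p"
  have eq: "emeasure ?P (G i) = (case i of (a, b) \<Rightarrow> ennreal (b - a))" if i: "i \<in> I" for i
  proof -
    obtain a b where ab: "i = (a, b)" "a \<in> T" "b \<in> T" "a \<le> b" using i by (auto simp: I_def)
    have "G i \<in> sets (sigma T (G ` I))" using i G by (auto intro: sigma_sets.Basic)
    then have "emeasure ?P (G i) = emeasure ?N (p -` G i \<inter> D)"
      by (subst emeasure_distr[OF meas]) (auto simp: space_restrict_space)
    also have "p -` G i \<inter> D = {a..<b}" using vim ab by (simp add: G_def)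
    also have "emeasure ?N {a..<b} = emeasure lborel {a..<b}"
      using D ab by (intro emeasure_restrict_space) (auto simp: D_def)
    finally show ?thesis using ab by simp
  qed
  have i: "(a, b) \<in> I" using ab by (simp add: I_def)
  have "emeasure M (G (a, b)) = (case (a, b) of (a, b) \<Rightarrow> ennreal (b - a))"
  proof (rule emeasure_extend_measure[where \<mu>' = "emeasure ?P" and G = G and I = I
        and \<mu> = "\<lambda>(a, b). ennreal (b - a)" and i = "(a, b)"])
    show "M = extend_measure T I G (\<lambda>(a, b). ennreal (b - a))" by (rule M_def)
    show "emeasure ?P (G i) = (case i of (a, b) \<Rightarrow> ennreal (b - a))" if "i \<in> I" for i
      using eq that .
    show "G ` I \<subseteq> Pow T" by (rule G)
    have "sets M = sets ?P" using setsM by simp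
    then show "positive (sets M) (emeasure ?P)" "countably_additive (sets M) (emeasure ?P)"
      using emeasure_positive[of ?P] emeasure_countably_additive[of ?P] by simp_all
  qed (rule i)
  moreover have "G (a, b) \<in> sets M"
    using i G setsM by (auto intro: sigma_sets.Basic)
  ultimately show ?thesis
    by (simp add: delta_measure_def M_def I_def G_def)
qed

definition delta_integral ::
    "real set \<Rightarrow> real \<Rightarrow> real \<Rightarrow> (real \<Rightarrow> 'a::{banach, second_countable_topology}) \<Rightarrow> 'a"
  where "delta_integral T a b f =
    (if a \<le> b then set_lebesgue_integral (delta_measure T) {a..<b} f
     else - set_lebesgue_integral (delta_measure T) {b..<a} f)"

definition locally_delta_integrable ::
    "real set \<Rightarrow> real \<Rightarrow> (real \<Rightarrow> 'a::{banach, second_countable_topology}) \<Rightarrow> bool"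
  where "locally_delta_integrable T s f \<longleftrightarrow>
    (\<forall>a\<in>T. \<forall>b\<in>T. s \<le> a \<longrightarrow> a \<le> b \<longrightarrow> set_integrable (delta_measure T) {a..b} f)"

text \<open>The filter \<open>at_top \<sqinter> principal T\<close> describes \<open>t \<rightarrow> \<infinity>\<close>, \<open>t \<in> T\<close>.\<close>

definition has_improper_delta_integral ::
    "real set \<Rightarrow> real \<Rightarrow> (real \<Rightarrow> 'a::{banach, second_countable_topology}) \<Rightarrow> 'a \<Rightarrow> bool"
  where "has_improper_delta_integral T s f I \<longleftrightarrow>
    locally_delta_integrable T s f \<and>
    ((\<lambda>t. delta_integral T s t f) \<longlongrightarrow> I) (inf at_top (principal T))"

definition cylinder_transformation :: "real \<Rightarrow> complex \<Rightarrow> complex"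
  where "cylinder_transformation h z =
    (if h = 0 then z else Ln (1 + of_real h * z) / of_real h)"

text \<open>\<open>delta_exp T p t s\<close> is \<open>e\<^sub>p(t, s)\<close>, for regressive \<open>p\<close>.\<close>

definition delta_exp :: "real set \<Rightarrow> (real \<Rightarrow> complex) \<Rightarrow> real \<Rightarrow> real \<Rightarrow> complex"
  where "delta_exp T p t s =
    exp (delta_integral T s t (\<lambda>\<eta>. cylinder_transformation (graininess T \<eta>) (p \<eta>)))"

definition circle_minus :: "real set \<Rightarrow> (real \<Rightarrow> complex) \<Rightarrow> real \<Rightarrow> complex"
  where "circle_minus T p t = - p t / (1 + of_real (graininess T t) * p t)"

definition circle_dot :: "real set \<Rightarrow> nat \<Rightarrow> real \<Rightarrow> real \<Rightarrow> real"
  where "circle_dot T n c t =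
    (if graininess T t > 0
     then ((1 + graininess T t * c) ^ n - 1) / graininess T t
     else of_nat n * c)"

definition laplace_integrand ::
    "real set \<Rightarrow> real \<Rightarrow> (real \<Rightarrow> complex) \<Rightarrow> complex \<Rightarrow> real \<Rightarrow> complex"
  where "laplace_integrand T s f z \<eta> =
    f \<eta> * delta_exp T (circle_minus T (\<lambda>_. z)) (forward_jump T \<eta>) s"

definition laplace_exists :: "real set \<Rightarrow> real \<Rightarrow> (real \<Rightarrow> complex) \<Rightarrow> complex \<Rightarrow> bool"
  where "laplace_exists T s f z \<longleftrightarrow>
    (\<exists>I. has_improper_delta_integral T s (laplace_integrand T s f z) I)"

definition laplace :: "real set \<Rightarrow> real \<Rightarrow> (real \<Rightarrow> complex) \<Rightarrow> complex \<Rightarrow> complex"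
  where "laplace T s f z =
    (THE I. has_improper_delta_integral T s (laplace_integrand T s f z) I)"

definition delta_null_function ::
    "real set \<Rightarrow> real \<Rightarrow> (real \<Rightarrow> complex) \<Rightarrow> bool"
  where "delta_null_function T s f \<longleftrightarrow> (\<forall>t\<in>T. s \<le> t \<longrightarrow> delta_integral T s t f = 0)"

end

theory Submission
  imports Defs
begin

text \<open>
Put \<open>g = f \<cdot> e\<^sub>\<ominus>\<^sub>\<alpha>(\<sigma>(\<cdot>), s)\<close> and \<open>W\<^sub>c = 1 / e\<^sub>c(\<sigma>(\<cdot>), s)\<close>, so that all integrals \<open>\<integral> g W\<^sub>c\<^sup>n\<close> vanish for \<open>c = \<zeta>\<^sub>k\<close>.
By Abel's inequality the partial integrals of \<open>g W\<^sub>c\<^sup>n\<close> are bounded uniformly in \<open>n\<close>, which allows one to sum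
the exponential series under the improper integral: \<open>\<integral> g (1 - exp (-C W\<^sub>c)) = 0\<close> for every \<open>C\<close>. As in Phragmen's
proof of Lerch's theorem, \<open>C = sqrt c \<cdot> e\<^sub>c(t, s)\<close> turns this weight into the indicator of \<open>\<sigma>(\<eta>) \<le> t\<close> as \<open>c = \<zeta>\<^sub>k \<rightarrow> \<infinity>\<close>;
the tail is again controlled by Abel's inequality. Hence \<open>\<integral>\<^sub>s\<^sup>t g = 0\<close> for all \<open>t\<close>, so \<open>g\<close>, and with it \<open>f\<close>, vanishes
almost everywhere.
\<close>

section \<open>Real-variable estimates\<close>

lemma sqrt_over_linear_tendsto_0:
  assumes "0 < L" shows "((\<lambda>x. sqrt x / (1 + x * L)) \<longlongrightarrow> 0) at_top"
proof (rule tendsto_sandwich)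
  show "\<forall>\<^sub>F x in at_top. 0 \<le> sqrt x / (1 + x * L)"
    using eventually_ge_at_top[of 0] by eventually_elim (use assms in simp)
  show "\<forall>\<^sub>F x in at_top. sqrt x / (1 + x * L) \<le> 1 / (L * sqrt x)"
    using eventually_gt_at_top[of 0]
  proof eventually_elim
    case (elim x)
    have "sqrt x / (1 + x * L) \<le> sqrt x / (x * L)"
      using elim assms by (intro divide_left_mono mult_pos_pos add_pos_pos) auto
    also have "\<dots> = sqrt x / (sqrt x * (L * sqrt x))" using elim by (simp add: mult.left_commute)
    also have "\<dots> = 1 / (L * sqrt x)" using elim by simp
    finally show ?case .
  qed
  have "filterlim (\<lambda>x. L * sqrt x) at_top at_top"
    using assms by (intro filterlim_tendsto_pos_mult_at_top[OF tendsto_const] sqrt_at_top)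
  then show "((\<lambda>x. 1 / (L * sqrt x)) \<longlongrightarrow> 0) at_top"
    by (intro tendsto_divide_0[OF tendsto_const] filterlim_at_top_imp_at_infinity)
qed simp

lemma borel_measurable_antimono:
  fixes h :: "real \<Rightarrow> real"
  assumes "antimono h" shows "h \<in> borel_measurable borel"
proof -
  have "mono (\<lambda>x. - h x)" using assms by (auto simp: mono_def antimono_def)
  from borel_measurable_uminus[OF borel_measurable_mono[OF this]] show ?thesis by simp
qed

text \<open>The \<open>j\<close>-th indicator is 1 exactly when \<open>j\<close> is at most the
  integer part of \<open>y * N / H\<close>. The sum is therefore this integer part, and the rounding
  error, less than 1, is rescaled by \<open>H / N\<close>.\<close>

lemma floor_layers:
  fixes y H :: real
  assumes "0 \<le> y" "y \<le> H" "0 < H" "0 < N"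
  shows "\<bar>y - H / real N * (\<Sum>j = 1..N. indicator {H * real j / real N..} y)\<bar> \<le> H / real N"
proof -
  define z where "z = y * real N / H"
  define m where "m = nat \<lfloor>z\<rfloor>"
  have z: "0 \<le> z" "z \<le> real N" using assms by (auto simp: z_def field_simps)
  then have m: "real m \<le> z" "z < real m + 1" "m \<le> N" by (auto simp: m_def) linarith+
  have "H * real j / real N \<le> y \<longleftrightarrow> j \<le> m" for j
  proof -
    have "H * real j / real N \<le> y \<longleftrightarrow> real j \<le> z" using assms by (simp add: z_def field_simps)
    also have "\<dots> \<longleftrightarrow> j \<le> m" using z by (simp add: m_def le_nat_floor le_nat_iff le_floor_iff)
    finally show ?thesis .
  qed
  then have "(\<Sum>j = 1..N. indicator {H * real j / real N..} y) = (\<Sum>j = 1..N. if j \<le> m then 1 else (0::real))"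
    by (intro sum.cong) (auto simp: indicator_def)
  also have "\<dots> = real (card {j \<in> {1..N}. j \<le> m})" by (simp add: sum.If_cases Int_def)
  also have "{j \<in> {1..N}. j \<le> m} = {1..m}" using m by auto
  finally have s: "(\<Sum>j = 1..N. indicator {H * real j / real N..} y) = real m" by simp
  have y: "y = H / real N * z" using assms by (simp add: z_def)
  have "y - H / real N * real m = H / real N * (z - real m)" by (simp add: y right_diff_distrib del: times_divide_eq_left)
  moreover have "\<bar>H / real N * (z - real m)\<bar> \<le> H / real N * 1"
    unfolding abs_mult using m assms by (intro mult_mono) auto
  ultimately show ?thesis using s by simp
qed

subsection \<open>The delta measure\<close>

locale unbounded_time_scale =
  fixes T :: "real set"
  assumes time_scale: "time_scale T" and unbounded: "\<not> bdd_above T"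
begin

abbreviation \<sigma> where "\<sigma> \<equiv> forward_jump T"
abbreviation \<mu> where "\<mu> \<equiv> graininess T"
abbreviation \<Delta> where "\<Delta> \<equiv> delta_measure T"

lemma closed_T: "closed T"
  using time_scale by (simp add: time_scale_def)

lemma ex_gt: "\<exists>u\<in>T. x < u"
  using unbounded by (meson bdd_above_def not_le)

lemma forward_jump_mem: "\<sigma> x \<in> T"
  unfolding forward_jump_def using ex_gt[of x]
  by (intro closed_subset_contains_Inf[OF closed_T]) (auto simp: bdd_below_def intro!: exI[of _ x])

lemma forward_jump_le: "u \<in> T \<Longrightarrow> x < u \<Longrightarrow> \<sigma> x \<le> u"
  unfolding forward_jump_def by (intro cInf_lower) (auto simp: bdd_below_def intro!: exI[of _ x])

lemma forward_jump_ge: "x \<le> \<sigma> x"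
  unfolding forward_jump_def using ex_gt[of x] by (intro cInf_greatest) auto

lemma mono_forward_jump: "mono \<sigma>"
proof (rule monoI)
  fix x y :: real assume "x \<le> y"
  show "\<sigma> x \<le> \<sigma> y"
  proof (cases "x < \<sigma> y")
    case True then show ?thesis by (intro forward_jump_le forward_jump_mem)
  next
    case False
    then have "x = y" using \<open>x \<le> y\<close> forward_jump_ge[of y] by simp
    then show ?thesis by simp
  qed
qed

lemma graininess_nonneg: "0 \<le> \<mu> x"
  using forward_jump_ge[of x] by (simp add: graininess_def)

lemma borel_measurable_forward_jump [measurable]: "\<sigma> \<in> borel_measurable borel"
  by (intro borel_measurable_mono mono_forward_jump)

lemma borel_measurable_graininess [measurable]: "\<mu> \<in> borel_measurable borel"
  unfolding graininess_def by measurable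

lemma space_delta [simp]: "space \<Delta> = T"
  unfolding delta_measure_def space_completion by (rule space_extend_measure) auto

section \<open>Generating intervals and Borel sets\<close>

definition "next_point x = Inf (T \<inter> {x..})"

lemma next_point: "next_point x \<in> T" "x \<le> next_point x"
proof -
  have "next_point x \<in> T \<inter> {x..}"
    unfolding next_point_def using closed_T ex_gt[of x]
    by (intro closed_contains_Inf) (auto simp: bdd_below_def intro: less_imp_le)
  then show "next_point x \<in> T" "x \<le> next_point x" by auto
qed

lemma next_point_le: "u \<in> T \<Longrightarrow> x \<le> u \<Longrightarrow> next_point x \<le> u"
  unfolding next_point_def by (intro cInf_lower) (auto simp: bdd_below_def intro!: exI[of _ x])

lemma next_point_le_iff: "u \<in> T \<Longrightarrow> next_point x \<le> u \<longleftrightarrow> x \<le> u"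
  using next_point[of x] next_point_le[of u x] by auto

text \<open>A point of \<open>T\<close> lies at or beyond \<open>x\<close> iff it lies at or beyond
  \<open>next_point x\<close>. Moving the endpoints in this way relates intervals with arbitrary
  real endpoints to the generator \<open>intervals\<close>, whose endpoints lie in
  \<open>T\<close>.\<close>

lemma Ico_next_point: "{x..<y} \<inter> T = {next_point x..<next_point y} \<inter> T"
  by (auto simp: next_point_le_iff simp flip: not_le)

definition "intervals = (\<lambda>(a, b). {a..<b} \<inter> T) ` {(a, b). a \<in> T \<and> b \<in> T \<and> a \<le> b}"

lemma intervals_subset: "intervals \<subseteq> Pow T"
  by (auto simp: intervals_def)

lemma Ico_in_intervals:
  assumes "a \<in> T" "b \<in> T" shows "{a..<b} \<inter> T \<in> intervals"
proof -
  \<comment> \<open>For \<open>b < a\<close> the set is empty and equals the interval from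
    \<open>b\<close> to \<open>b\<close>; \<open>min a b\<close> covers both orders of the
    endpoints.\<close>
  have "{a..<b} \<inter> T = (\<lambda>(a, b). {a..<b} \<inter> T) (min a b, b)" by (auto simp: min_def)
  moreover have "(min a b, b) \<in> {(a, b). a \<in> T \<and> b \<in> T \<and> a \<le> b}" using assms by (auto simp: min_def)
  ultimately show ?thesis unfolding intervals_def by blast
qed

lemma intervalsE:
  assumes "A \<in> intervals" obtains a b where "a \<in> T" "b \<in> T" "a \<le> b" "A = {a..<b} \<inter> T"
  using assms by (auto simp: intervals_def)

lemma Int_stable_intervals: "Int_stable intervals"
proof (rule Int_stableI)
  fix A B assume "A \<in> intervals" "B \<in> intervals"
  then obtain a b c d where *: "a \<in> T" "b \<in> T" "A = {a..<b} \<inter> T" "c \<in> T" "d \<in> T" "B = {c..<d} \<inter> T"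
    by (auto elim!: intervalsE)
  then have "A \<inter> B = {max a c..<min b d} \<inter> T" by auto
  moreover have "max a c \<in> T" "min b d \<in> T" using * by (auto simp: max_def min_def)
  ultimately show "A \<inter> B \<in> intervals" using Ico_in_intervals by metis
qed

text \<open>Separates the generated \<sigma>-algebra from the null sets added by completion:
  induction over generators reaches only the former, and the latter are treated afterwards.\<close>

lemma delta_eq_completion: obtains M where
  "\<Delta> = completion M" "space M = T" "sets M = sigma_sets T intervals"
proof
  let ?M = "extend_measure T {(a, b). a \<in> T \<and> b \<in> T \<and> a \<le> b}
      (\<lambda>(a, b). {a..<b} \<inter> T) (\<lambda>(a, b). ennreal (b - a))"
  show "\<Delta> = completion ?M" by (simp add: delta_measure_def)
  show "space ?M = T" by (rule space_extend_measure) auto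
  show "sets ?M = sigma_sets T intervals"
    using intervals_subset by (subst sets_extend_measure) (auto simp: intervals_def)
qed

lemma lessThan_in_sigma_sets: "{..<y} \<inter> T \<in> sigma_sets T intervals"
proof -
  have "{..<y} \<inter> T = (\<Union>n::nat. {next_point (- real n)..<next_point y} \<inter> T)"
  proof -
    have "\<exists>n::nat. - real n \<le> x" for x using real_arch_simple[of "-x"] by (auto simp: minus_le_iff)
    moreover have "{..<y} \<inter> T = (\<Union>n::nat. {- real n..<y} \<inter> T)" using calculation by auto
    ultimately show ?thesis by (subst (asm) Ico_next_point)
  qed
  also have "\<dots> \<in> sigma_sets T intervals"
    by (intro sigma_sets.Union sigma_sets.Basic Ico_in_intervals next_point)
  finally show ?thesis .
qed

lemma borel_Int_in_sets:
  assumes "A \<in> sets borel" shows "A \<inter> T \<in> sets \<Delta>"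
proof -
  obtain M where M: "\<Delta> = completion M" "space M = T" "sets M = sigma_sets T intervals"
    by (rule delta_eq_completion)
  have "(\<lambda>x. x) \<in> borel_measurable M"
  proof (rule borel_measurableI_less)
    fix y
    have "{x \<in> space M. x < y} = {..<y} \<inter> T" using M by auto
    then show "{x \<in> space M. x < y} \<in> sets M" using lessThan_in_sigma_sets M by simp
  qed
  from measurable_sets[OF this assms] have "A \<inter> T \<in> sets M" using M by simp
  then show ?thesis using M by simp
qed

lemma borel_measurable_delta:
  assumes "f \<in> borel_measurable borel" shows "f \<in> borel_measurable \<Delta>"
proof (rule measurableI)
  fix A :: "'a set" assume "A \<in> sets borel"
  from measurable_sets[OF assms this] show "f -` A \<inter> space \<Delta> \<in> sets \<Delta>"
    using borel_Int_in_sets by simp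
qed simp

lemma emeasure_Ico: "a \<in> T \<Longrightarrow> b \<in> T \<Longrightarrow> a \<le> b \<Longrightarrow> emeasure \<Delta> ({a..<b} \<inter> T) = ennreal (b - a)"
  by (rule emeasure_delta_measure_Ico[OF time_scale unbounded])

text \<open>Right-density provides points \<open>u\<close> of \<open>T\<close> arbitrarily close to
  \<open>c\<close> from the right, and \<open>{c..<u} \<inter> T\<close> has measure
  \<open>u - c\<close>. Hence the endpoint of a segment may be added or dropped at such a
  point.\<close>

lemma right_dense_null:
  assumes "c \<in> T" "\<sigma> c = c" shows "{c} \<in> null_sets \<Delta>"
proof -
  have s: "{c} \<in> sets \<Delta>" using borel_Int_in_sets[of "{c}"] assms by simp
  have e: "emeasure \<Delta> {c} \<le> ennreal e" if "e > 0" for e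
  proof -
    have "\<exists>u\<in>T. c < u \<and> u < c + e"
    proof (rule ccontr)
      assume "\<not> ?thesis"
      then have "c + e \<le> \<sigma> c"
        unfolding forward_jump_def using ex_gt[of c] by (intro cInf_greatest) auto
      then show False using assms that by simp
    qed
    then obtain u where u: "u \<in> T" "c < u" "u < c + e" by blast
    have "emeasure \<Delta> {c} \<le> emeasure \<Delta> ({c..<u} \<inter> T)"
      using u assms borel_Int_in_sets[of "{c..<u}"] by (intro emeasure_mono) auto
    also have "\<dots> \<le> ennreal e" using u assms by (subst emeasure_Ico) (auto intro!: ennreal_leI)
    finally show ?thesis .
  qed
  have "emeasure \<Delta> {c} \<le> 0"
    by (rule ennreal_le_epsilon) (use e in simp)
  then show ?thesis using s by (auto simp: null_sets_def)
qed

lemma finite_emeasure_Ico: "emeasure \<Delta> ({x..<y} \<inter> T) < \<infinity>"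
proof (cases "next_point x \<le> next_point y")
  case True
  then show ?thesis by (subst Ico_next_point) (simp add: emeasure_Ico next_point)
next
  case False
  then show ?thesis by (subst Ico_next_point) auto
qed

lemma set_integrable_Int_T: "set_integrable \<Delta> (A \<inter> T) f \<longleftrightarrow> set_integrable \<Delta> A f"
  unfolding set_integrable_def by (intro Bochner_Integration.integrable_cong) (auto split: split_indicator)

lemma set_integral_Int_T: "(LINT x:A \<inter> T|\<Delta>. f x) = (LINT x:A|\<Delta>. f x)"
  unfolding set_lebesgue_integral_def by (intro Bochner_Integration.integral_cong) (auto split: split_indicator)

lemma set_integrable_subset_borel:
  fixes f :: "real \<Rightarrow> 'a::{banach, second_countable_topology}"
  assumes "set_integrable \<Delta> A f" "B \<inter> T \<subseteq> A" "B \<in> sets borel"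
  shows "set_integrable \<Delta> B f"
  using set_integrable_subset[OF assms(1) borel_Int_in_sets[OF assms(3)] assms(2)]
  by (simp add: set_integrable_Int_T)

lemma set_integrable_mult_bounded:
  fixes f :: "real \<Rightarrow> 'a::{banach, second_countable_topology}"
  assumes "set_integrable \<Delta> A f" "h \<in> borel_measurable borel" "\<And>x. x \<in> A \<Longrightarrow> x \<in> T \<Longrightarrow> \<bar>h x\<bar> \<le> K"
  shows "set_integrable \<Delta> A (\<lambda>x. h x *\<^sub>R f x)"
proof -
  let ?F = "\<lambda>x. indicator A x *\<^sub>R f x"
  have F: "integrable \<Delta> ?F" using assms by (simp add: set_integrable_def)
  have "integrable \<Delta> (\<lambda>x. h x *\<^sub>R ?F x)"
  proof (rule Bochner_Integration.integrable_bound)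
    show "integrable \<Delta> (\<lambda>x. K *\<^sub>R ?F x)" by (rule integrable_scaleR_right[OF F])
    show "(\<lambda>x. h x *\<^sub>R ?F x) \<in> borel_measurable \<Delta>"
      by (intro borel_measurable_scaleR borel_measurable_delta[OF assms(2)] borel_measurable_integrable[OF F])
    show "AE x in \<Delta>. norm (h x *\<^sub>R ?F x) \<le> norm (K *\<^sub>R ?F x)"
    proof (rule AE_I2)
      fix x assume "x \<in> space \<Delta>"
      then show "norm (h x *\<^sub>R ?F x) \<le> norm (K *\<^sub>R ?F x)"
        using assms(3)[of x] by (auto split: split_indicator intro!: mult_right_mono)
    qed
  qed
  then show ?thesis by (simp add: set_integrable_def mult.commute)
qed

subsection \<open>Abel's inequality\<close>

text \<open>Reduces superlevel sets of monotone weights to intervals with endpoints in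
  \<open>T\<close>. Below the first exit point \<open>c\<close> every point of \<open>T\<close> from
  \<open>a\<close> on is in \<open>L\<close>, and above \<open>c\<close> no point of
  \<open>{a..<b}\<close> is. Only \<open>c\<close> is undecided, and where it makes a difference it
  is right-dense, hence null.\<close>

lemma set_integral_down_closed:
  fixes g :: "real \<Rightarrow> 'a::{banach, second_countable_topology}"
  assumes ab: "a \<in> T" "b \<in> T" "a \<le> b"
    and L: "L \<in> sets borel" "\<And>x y. y \<in> L \<Longrightarrow> x \<le> y \<Longrightarrow> x \<in> L"
    and g: "set_integrable \<Delta> {a..<b} g"
  obtains c where "c \<in> T" "a \<le> c" "c \<le> b" "(LINT x:{a..<b} \<inter> L|\<Delta>. g x) = (LINT x:{a..<c}|\<Delta>. g x)"
proof -
  \<comment> \<open>Inserting \<open>b\<close> keeps \<open>R\<close> nonempty and gives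
    \<open>c = b\<close> when \<open>L\<close> contains all of
    \<open>{a..<b} \<inter> T\<close>.\<close>
  define R where "R = insert b (T \<inter> {a..<b} - L)"
  define c where "c = Inf R"
  have ge: "a \<le> x" if "x \<in> R" for x using that ab by (auto simp: R_def)
  then have bdd: "bdd_below R" by (auto simp: bdd_below_def)
  have c: "c \<in> T" unfolding c_def
    using ab bdd by (intro closed_subset_contains_Inf[OF closed_T]) (auto simp: R_def)
  have ac: "a \<le> c" unfolding c_def using ge by (intro cInf_greatest) (auto simp: R_def)
  have cR: "c \<le> x" if "x \<in> R" for x unfolding c_def using bdd that by (intro cInf_lower)
  then have cb: "c \<le> b" by (auto simp: R_def)
  have sub: "{a..<c} \<inter> T \<subseteq> L"
  proof
    fix x assume x: "x \<in> {a..<c} \<inter> T"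
    then have "x \<notin> R" using cR[of x] by auto
    then show "x \<in> L" using x cb by (auto simp: R_def)
  qed
  have sup: "x \<le> c" if "x \<in> {a..<b} \<inter> L" for x
  proof (rule ccontr)
    assume "\<not> x \<le> c"
    then have "Inf R < x" by (simp add: c_def)
    moreover have "R \<noteq> {}" by (simp add: R_def)
    ultimately obtain u where u: "u \<in> R" "u < x" using cInf_lessD by blast
    then have "u \<in> L" using L(2)[of x u] that by auto
    then show False using u that by (auto simp: R_def)
  qed
  have ae: "AE x in \<Delta>. x \<in> {a..<b} \<inter> L \<longleftrightarrow> x \<in> {a..<c}"
  proof (cases "c \<in> L \<and> c < b")
    case False
    then have "x \<in> {a..<b} \<inter> L \<longleftrightarrow> x \<in> {a..<c}" if "x \<in> T" for x
      using that sub sup[of x] cb by (cases "x = c") auto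
    then show ?thesis by (intro AE_I2) auto
  next
    case True
    \<comment> \<open>Here \<open>c\<close> is not in \<open>R\<close>, so the infimum is not
      attained; a gap of \<open>T\<close> after \<open>c\<close> would keep \<open>R\<close> at a
      positive distance from \<open>c\<close>.\<close>
    have "\<sigma> c \<le> c"
    proof (rule ccontr)
      assume n: "\<not> \<sigma> c \<le> c"
      have "min (\<sigma> c) b \<le> x" if "x \<in> R" for x
      proof -
        have "x \<noteq> c" using that True by (auto simp: R_def)
        then have "c < x" using cR[OF that] by simp
        moreover have "x \<in> T" using that ab by (auto simp: R_def)
        ultimately have "\<sigma> c \<le> x" by (intro forward_jump_le)
        then show ?thesis by simp
      qed
      then have "min (\<sigma> c) b \<le> c" unfolding c_def by (intro cInf_greatest) (auto simp: R_def)
      then show False using n True by auto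
    qed
    then have "{c} \<in> null_sets \<Delta>"
      using right_dense_null[OF c] forward_jump_ge[of c] by simp
    from AE_not_in[OF this] have "AE x in \<Delta>. x \<noteq> c" by simp
    moreover have "AE x in \<Delta>. x \<in> T" by (intro AE_I2) simp
    ultimately show ?thesis
    proof eventually_elim
      case (elim x)
      then show ?case using sub sup[of x] cb by auto
    qed
  qed
  have "set_integrable \<Delta> ({a..<b} \<inter> L) g" "set_integrable \<Delta> {a..<c} g"
    using L(1) cb by (auto intro!: set_integrable_subset_borel[OF g])
  then have "(LINT x:{a..<b} \<inter> L|\<Delta>. g x) = (LINT x:{a..<c}|\<Delta>. g x)"
    using ae unfolding set_integrable_def
    by (intro set_integral_cong_set) (auto simp: set_borel_measurable_def elim: eventually_mono)
  then show ?thesis using that c ac cb by blast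
qed

text \<open>The weight \<open>h\<close> is a uniform limit of averages of indicators of
  its superlevel sets, and each superlevel set is an initial segment.\<close>

lemma norm_set_integral_antimono_le:
  fixes g :: "real \<Rightarrow> 'a::{banach, second_countable_topology}"
  assumes ab: "a \<in> T" "b \<in> T" "a \<le> b"
    and h: "antimono h" "\<And>x. 0 \<le> h x"
    and g: "set_integrable \<Delta> {a..<b} g"
    and B: "\<And>c. c \<in> T \<Longrightarrow> a \<le> c \<Longrightarrow> c \<le> b \<Longrightarrow> norm (LINT x:{a..<c}|\<Delta>. g x) \<le> B"
  shows "norm (LINT x:{a..<b}|\<Delta>. h x *\<^sub>R g x) \<le> h a * B"
proof (cases "h a = 0")
  case True
  have "h x = 0" if "x \<in> {a..<b}" for x
    using that antimonoD[OF h(1), of a x] h(2)[of x] True by auto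
  then have "(LINT x:{a..<b}|\<Delta>. h x *\<^sub>R g x) = (LINT x:{a..<b}|\<Delta>. 0)"
    unfolding set_lebesgue_integral_def
    by (intro Bochner_Integration.integral_cong) (auto split: split_indicator)
  then show ?thesis using True by simp
next
  case False
  then have H: "0 < h a" using h(2)[of a] by simp
  have hm: "h \<in> borel_measurable borel" using h(1) by (rule borel_measurable_antimono)
  define I where "I = (LINT x:{a..<b}|\<Delta>. h x *\<^sub>R g x)"
  define K where "K = (LINT x:{a..<b}|\<Delta>. norm (g x))"
  have hb: "0 \<le> h x" "h x \<le> h a" if "x \<in> {a..<b}" for x
    using that h antimonoD[OF h(1), of a x] by auto
  have gn: "set_integrable \<Delta> {a..<b} (\<lambda>x. norm (g x))"
    using integrable_norm[OF g[unfolded set_integrable_def]] by (simp add: set_integrable_def)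
  have hg: "set_integrable \<Delta> {a..<b} (\<lambda>x. h x *\<^sub>R g x)"
    using hb by (intro set_integrable_mult_bounded[OF g hm, of "h a"]) auto
  have main: "norm I \<le> h a * B + h a / real N * K" if N: "0 < N" for N
  proof -
    define S where "S j = {x. h a * real j / real N \<le> h x}" for j
    have S: "S j \<in> sets borel" for j using hm unfolding S_def by measurable
    define hN where "hN x = h a / real N * (\<Sum>j = 1..N. indicator (S j) x)" for x
    have hNm: "hN \<in> borel_measurable borel" unfolding hN_def using S by measurable
    have close: "\<bar>h x - hN x\<bar> \<le> h a / real N" if "x \<in> {a..<b}" for x
      using floor_layers[OF hb[OF that] H N] by (simp add: hN_def S_def indicator_def)
    \<comment> \<open>A superlevel set of an antimonotone function is closed downwards, so the
      integral over it is one of the partial integrals bounded by \<open>B\<close>.\<close>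
    have piece: "norm (LINT x:{a..<b} \<inter> S j|\<Delta>. g x) \<le> B" for j
    proof -
      obtain c where "c \<in> T" "a \<le> c" "c \<le> b" "(LINT x:{a..<b} \<inter> S j|\<Delta>. g x) = (LINT x:{a..<c}|\<Delta>. g x)"
        by (rule set_integral_down_closed[OF ab S[of j] _ g])
          (use h(1) in \<open>auto simp: S_def dest: antimonoD intro: order_trans\<close>)
      then show ?thesis using B by simp
    qed
    have Si: "integrable \<Delta> (\<lambda>x. indicator ({a..<b} \<inter> S j) x *\<^sub>R g x)" for j
      using set_integrable_subset_borel[OF g, of "{a..<b} \<inter> S j"] S[of j] by (auto simp: set_integrable_def)
    have "(LINT x:{a..<b}|\<Delta>. hN x *\<^sub>R g x)
        = (LINT x|\<Delta>. (h a / real N) *\<^sub>R (\<Sum>j = 1..N. indicator ({a..<b} \<inter> S j) x *\<^sub>R g x))"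
      unfolding set_lebesgue_integral_def
    proof (intro Bochner_Integration.integral_cong refl)
      show "indicator {a..<b} x *\<^sub>R hN x *\<^sub>R g x
          = (h a / real N) *\<^sub>R (\<Sum>j = 1..N. indicator ({a..<b} \<inter> S j) x *\<^sub>R g x)" for x
        by (cases "x \<in> {a..<b}")
          (simp_all add: hN_def indicator_inter_arith flip: scaleR_sum_left)
    qed
    also have "\<dots> = (h a / real N) *\<^sub>R (\<Sum>j = 1..N. (LINT x:{a..<b} \<inter> S j|\<Delta>. g x))"
      by (simp only: set_lebesgue_integral_def integral_scaleR_right Bochner_Integration.integral_sum[OF Si])
    also have "norm \<dots> \<le> h a / real N * (\<Sum>j = 1..N. B)"
    proof -
      have le: "norm (\<Sum>j = 1..N. (LINT x:{a..<b} \<inter> S j|\<Delta>. g x)) \<le> (\<Sum>j = 1..N. B)"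
        by (intro sum_norm_le piece)
      then show ?thesis
        using H mult_left_mono[OF le, of "h a / real N"] by (simp del: sum_constant)
    qed
    also have "\<dots> = h a * B" using N by simp
    finally have 1: "norm (LINT x:{a..<b}|\<Delta>. hN x *\<^sub>R g x) \<le> h a * B" .
    have hd: "(\<lambda>x. h x - hN x) \<in> borel_measurable borel" using hm hNm by measurable
    have di: "set_integrable \<Delta> {a..<b} (\<lambda>x. (h x - hN x) *\<^sub>R g x)"
      using close by (intro set_integrable_mult_bounded[OF g hd]) auto
    have "(\<lambda>x. hN x *\<^sub>R g x) = (\<lambda>x. h x *\<^sub>R g x - (h x - hN x) *\<^sub>R g x)"
      by (auto simp: algebra_simps)
    then have "(LINT x:{a..<b}|\<Delta>. hN x *\<^sub>R g x) = I - (LINT x:{a..<b}|\<Delta>. (h x - hN x) *\<^sub>R g x)"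
      using set_integral_diff(2)[OF hg di] by (simp add: I_def)
    moreover have "norm (LINT x:{a..<b}|\<Delta>. (h x - hN x) *\<^sub>R g x) \<le> h a / real N * K"
    proof -
      have "norm (LINT x:{a..<b}|\<Delta>. (h x - hN x) *\<^sub>R g x)
          \<le> (LINT x|\<Delta>. norm (indicator {a..<b} x *\<^sub>R (h x - hN x) *\<^sub>R g x))"
        unfolding set_lebesgue_integral_def by (rule integral_norm_bound)
      also have "\<dots> \<le> (LINT x|\<Delta>. h a / real N * (indicator {a..<b} x *\<^sub>R norm (g x)))"
      proof (rule integral_mono)
        show "integrable \<Delta> (\<lambda>x. norm (indicator {a..<b} x *\<^sub>R (h x - hN x) *\<^sub>R g x))"
          using di by (intro integrable_norm) (simp add: set_integrable_def)
        show "integrable \<Delta> (\<lambda>x. h a / real N * (indicator {a..<b} x *\<^sub>R norm (g x)))"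
          using gn by (intro integrable_mult_right) (simp add: set_integrable_def)
        show "norm (indicator {a..<b} x *\<^sub>R (h x - hN x) *\<^sub>R g x)
            \<le> h a / real N * (indicator {a..<b} x *\<^sub>R norm (g x))" for x
          using close[of x] mult_right_mono[OF close[of x], of "norm (g x)"]
          by (auto split: split_indicator)
      qed
      also have "\<dots> = h a / real N * K" by (simp add: K_def set_lebesgue_integral_def)
      finally show ?thesis .
    qed
    ultimately show ?thesis
      using 1 norm_triangle_ineq[of "LINT x:{a..<b}|\<Delta>. hN x *\<^sub>R g x" "LINT x:{a..<b}|\<Delta>. (h x - hN x) *\<^sub>R g x"]
      by simp
  qed
  \<comment> \<open>\<open>K\<close> is the integral of \<open>norm (g x)\<close> and does not
    depend on \<open>N\<close>, so the approximation error disappears in the limit.\<close>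
  have "(\<lambda>N. h a * B + h a * K * (1 / real N)) \<longlonglongrightarrow> h a * B + h a * K * 0"
    by (intro tendsto_intros lim_1_over_n)
  then have "norm I \<le> h a * B + h a * K * 0"
    by (rule tendsto_lowerbound) (use main in \<open>auto intro!: eventually_sequentiallyI[of 1]\<close>)
  then show ?thesis by (simp add: I_def)
qed

subsection \<open>Integrable functions with vanishing partial integrals\<close>

lemma sigma_finite_delta: "sigma_finite_measure \<Delta>"
proof
  let ?C = "range (\<lambda>n::nat. {- real n..<real n} \<inter> T)"
  have "\<exists>n::nat. - real n \<le> x \<and> x < real n" for x
  proof -
    obtain n where "\<bar>x\<bar> < real n" using reals_Archimedean2 by blast
    then show ?thesis by (intro exI[of _ n]) auto
  qed
  then have "\<Union>?C = space \<Delta>" by auto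
  moreover have "?C \<subseteq> sets \<Delta>" by (auto intro: borel_Int_in_sets)
  moreover have "\<forall>A\<in>?C. emeasure \<Delta> A \<noteq> \<infinity>" using finite_emeasure_Ico by (auto simp: less_top)
  ultimately show "\<exists>C. countable C \<and> C \<subseteq> sets \<Delta> \<and> \<Union>C = space \<Delta> \<and> (\<forall>A\<in>C. emeasure \<Delta> A \<noteq> \<infinity>)"
    by (intro exI[of _ ?C]) auto
qed

text \<open>Differences of initial segments give integral 0 over the generating intervals, Dynkin's
  theorem extends this to the generated \<sigma>-algebra, and discarding null sets extends it to the
  completion. A function with integral 0 over every measurable set vanishes almost
  everywhere.\<close>

lemma AE_eq_0_if_integrals_eq_0:
  fixes f :: "real \<Rightarrow> 'a::{banach, second_countable_topology}"
  assumes st: "s \<in> T" "t \<in> T" "s \<le> t"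
    and f: "set_integrable \<Delta> {s..<t} f"
    and 0: "\<And>u. u \<in> T \<Longrightarrow> s \<le> u \<Longrightarrow> u \<le> t \<Longrightarrow> (LINT x:{s..<u}|\<Delta>. f x) = 0"
  shows "AE x in \<Delta>. x \<in> {s..<t} \<longrightarrow> f x = 0"
proof -
  let ?F = "\<lambda>x. indicator {s..<t} x *\<^sub>R f x"
  have F: "integrable \<Delta> ?F" using f by (simp add: set_integrable_def)
  have Fs: "set_integrable \<Delta> A ?F" if "A \<in> sets \<Delta>" for A
    using integrable_mult_indicator[OF that F] by (simp add: set_integrable_def)
  obtain M where M: "\<Delta> = completion M" "space M = T" "sets M = sigma_sets T intervals"
    by (rule delta_eq_completion)
  have sM: "A \<in> sets \<Delta>" if "A \<in> sigma_sets T intervals" for A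
    using that M by simp
  \<comment> \<open>The complement step of the induction subtracts from the integral over all of
    \<open>T\<close>.\<close>
  have total: "(LINT x:T|\<Delta>. ?F x) = 0"
  proof -
    have "(LINT x:T|\<Delta>. ?F x) = (LINT x:{s..<t}|\<Delta>. f x)"
      unfolding set_lebesgue_integral_def
      by (intro Bochner_Integration.integral_cong) auto
    then show ?thesis using 0 st by simp
  qed
  have int0: "(LINT x:A|\<Delta>. ?F x) = 0" if "A \<in> sigma_sets T intervals" for A
    using Int_stable_intervals intervals_subset that
  proof (induction rule: sigma_sets_induct_disjoint)
    case (basic A)
    then obtain a b where A: "a \<in> T" "b \<in> T" "a \<le> b" "A = {a..<b} \<inter> T" by (rule intervalsE)
    \<comment> \<open>Clipping the endpoints to the range from \<open>s\<close> to \<open>t\<close>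
      keeps them in \<open>T\<close> and does not change the integral of \<open>?F\<close>, which is
      0 outside \<open>{s..<t}\<close>.\<close>
    define c d where "c = min t (max s a)" and "d = min t (max s b)"
    have cd: "c \<in> T" "d \<in> T" "s \<le> c" "c \<le> d" "d \<le> t"
      using st A by (auto simp: c_def d_def min_def max_def)
    have "(LINT x:A|\<Delta>. ?F x) = (LINT x:{c..<d}|\<Delta>. f x)"
      unfolding set_lebesgue_integral_def
      by (intro Bochner_Integration.integral_cong) (auto simp: A c_def d_def split: split_indicator)
    moreover have "(LINT x:{s..<d}|\<Delta>. f x) = (LINT x:{s..<c}|\<Delta>. f x) + (LINT x:{c..<d}|\<Delta>. f x)"
    proof -
      have "{s..<d} = {s..<c} \<union> {c..<d}" using cd by auto
      then show ?thesis using cd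
        by (simp only:) (intro set_integral_Un set_integrable_subset_borel[OF f], auto)
    qed
    ultimately show ?case using 0[of c] 0[of d] cd by simp
  next
    case empty
    show ?case by (simp add: set_lebesgue_integral_def)
  next
    case (compl A)
    have "A \<subseteq> T" using compl(1) intervals_subset sigma_sets_into_sp by blast
    then have "(LINT x:A \<union> (T - A)|\<Delta>. ?F x) = 0" using total by (simp add: Un_absorb1)
    then show ?case using compl
      by (subst (asm) set_integral_Un) (auto intro!: Fs sM sigma_sets.Compl)
  next
    case (union A)
    have A: "A i \<in> sets \<Delta>" for i using union(2) sM by auto
    then have "(LINT x:(\<Union>i. A i)|\<Delta>. ?F x) = (\<Sum>i. (LINT x:A i|\<Delta>. ?F x))"
      using union(1) by (intro lebesgue_integral_countable_add Fs) (auto simp: disjoint_family_on_def)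
    then show ?case using union(3) by simp
  qed
  have "AE x in \<Delta>. ?F x = 0"
  proof (rule sigma_finite_measure.density_zero[OF sigma_finite_delta F])
    \<comment> \<open>A set of the completion differs from a set \<open>S\<close> of the generated
      \<sigma>-algebra only within a null set.\<close>
    fix A assume A: "A \<in> sets \<Delta>"
    then obtain S N N' where S: "A = S \<union> N" "N \<subseteq> N'" "N' \<in> null_sets M" "S \<in> sets M"
      unfolding M(1) by (rule sets_completionE)
    have "AE x in \<Delta>. x \<notin> N'" using S(3) M(1) by (simp add: AE_not_in null_sets_completionI)
    then have "AE x in \<Delta>. x \<in> S \<longleftrightarrow> x \<in> A" by eventually_elim (use S in auto)
    moreover have "S \<in> sets \<Delta>" using S M sM by simp
    ultimately have "(LINT x:A|\<Delta>. ?F x) = (LINT x:S|\<Delta>. ?F x)"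
      using Fs[OF A] Fs[of S]
      by (intro set_integral_cong_set) (auto simp: set_borel_measurable_def set_integrable_def)
    then show "(LINT x:A|\<Delta>. ?F x) = 0" using int0 S M by simp
  qed
  then show ?thesis by (auto elim!: eventually_mono)
qed

subsection \<open>The exponential function\<close>

text \<open>In the usual notation \<open>log_rate c x = \<xi>\<^bsub>\<mu>(x)\<^esub>(c)\<close> and \<open>decay c s t = 1 / e\<^sub>c(t, s)\<close> for \<open>s \<le> t\<close>.\<close>

definition log_rate :: "real \<Rightarrow> real \<Rightarrow> real"
  where "log_rate c x = (if \<mu> x = 0 then c else ln (1 + \<mu> x * c) / \<mu> x)"

definition decay :: "real \<Rightarrow> real \<Rightarrow> real \<Rightarrow> real"
  where "decay c s t = exp (- (LINT x:{s..<t}|\<Delta>. log_rate c x))"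

lemma borel_measurable_log_rate [measurable]: "log_rate c \<in> borel_measurable borel"
  unfolding log_rate_def by measurable

lemma log_rate_bounds:
  assumes "0 \<le> c" shows "0 \<le> log_rate c x" "log_rate c x \<le> c"
proof -
  have "ln (1 + \<mu> x * c) \<le> \<mu> x * c"
    using assms graininess_nonneg[of x] by (intro ln_add_one_self_le_self) simp
  then show "log_rate c x \<le> c"
    using graininess_nonneg[of x] by (auto simp: log_rate_def field_simps)
  show "0 \<le> log_rate c x"
    using assms graininess_nonneg[of x] by (auto simp: log_rate_def intro!: divide_nonneg_nonneg ln_ge_zero)
qed

lemma set_integrable_const: "set_integrable \<Delta> {a..<b} (\<lambda>_. k :: real)"
proof -
  have "set_integrable \<Delta> ({a..<b} \<inter> T) (\<lambda>_. k)"
    using finite_emeasure_Ico[of a b] borel_Int_in_sets[of "{a..<b}"]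
    by (simp add: set_integrable_def less_top)
  then show ?thesis by (simp add: set_integrable_Int_T)
qed

lemma set_integrable_log_rate:
  assumes "0 \<le> c" shows "set_integrable \<Delta> {a..<b} (log_rate c)"
  using set_integrable_mult_bounded[OF set_integrable_const[of a b 1], of "log_rate c" c]
    log_rate_bounds[OF assms] by simp

lemma decay_pos: "0 < decay c s t"
  by (simp add: decay_def)

lemma set_integral_log_rate_nonneg: "0 \<le> c \<Longrightarrow> 0 \<le> (LINT x:A|\<Delta>. log_rate c x)"
  unfolding set_lebesgue_integral_def by (intro integral_nonneg_AE AE_I2) (simp add: log_rate_bounds)

lemma decay_le_1: "0 \<le> c \<Longrightarrow> decay c s t \<le> 1"
  by (simp add: decay_def set_integral_log_rate_nonneg)

lemma decay_split:
  assumes "0 \<le> c" "s \<le> t" "t \<le> u"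
  shows "decay c s u = decay c s t * decay c t u"
proof -
  have "{s..<u} = {s..<t} \<union> {t..<u}" using assms by auto
  then have "(LINT x:{s..<u}|\<Delta>. log_rate c x) = (LINT x:{s..<t}|\<Delta>. log_rate c x) + (LINT x:{t..<u}|\<Delta>. log_rate c x)"
    using assms by (simp only:) (intro set_integral_Un set_integrable_log_rate, auto)
  then show ?thesis by (simp add: decay_def exp_add[symmetric])
qed

lemma antimono_decay:
  assumes "0 \<le> c" shows "antimono (decay c s)"
proof (rule antimonoI)
  fix t u :: real assume tu: "t \<le> u"
  show "decay c s u \<le> decay c s t"
  proof (cases "s \<le> t")
    case True
    then show ?thesis using tu decay_split[OF assms True tu] decay_le_1[OF assms, of t u] decay_pos[of c s t]
      by (simp add: mult_le_cancel_left1)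
  next
    case False
    then have "decay c s t = 1" by (simp add: decay_def set_lebesgue_integral_def)
    then show ?thesis using decay_le_1[OF assms] by simp
  qed
qed

text \<open>By concavity of \<open>ln\<close>, the quotient \<open>ln (1 + m * c) / m\<close>
  decreases in \<open>m\<close>, and the graininess on \<open>{t..<u}\<close> never exceeds
  \<open>u - t\<close>. So the rate is at least that of a single jump from \<open>t\<close> to
  \<open>u\<close>. This is Bernoulli's inequality for the exponential function on
  \<open>T\<close>.\<close>

lemma decay_bound:
  assumes "0 \<le> c" "t \<in> T" "u \<in> T" "t < u"
  shows "decay c t u \<le> 1 / (1 + c * (u - t))"
proof -
  define L where "L = u - t"
  have L: "0 < L" using assms by (simp add: L_def)
  have p: "0 < 1 + c * L" using assms L by (simp add: add_pos_nonneg)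
  have rate: "ln (1 + c * L) / L \<le> log_rate c x" if x: "x \<in> {t..<u}" for x
  proof (cases "\<mu> x = 0")
    case True
    have "ln (1 + c * L) \<le> c * L" using assms L by (intro ln_add_one_self_le_self) simp
    then show ?thesis using True L by (simp add: log_rate_def field_simps)
  next
    case False
    define m where "m = \<mu> x"
    have m: "0 < m" using False graininess_nonneg[of x] by (simp add: m_def)
    \<comment> \<open>A jump from \<open>x < u\<close> cannot pass \<open>u\<close>, because
      \<open>u\<close> is in \<open>T\<close>.\<close>
    have mL: "m \<le> L" using forward_jump_le[OF assms(3), of x] x by (auto simp: m_def L_def graininess_def)
    \<comment> \<open>\<open>1 + m * c\<close> is the convex combination of \<open>1\<close> and
      \<open>1 + c * L\<close> with weight \<open>m / L\<close>.\<close>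
    have "(1 - m / L) * ln 1 + m / L * ln (1 + c * L) \<le> ln ((1 - m / L) *\<^sub>R 1 + (m / L) *\<^sub>R (1 + c * L))"
      using m mL L p by (intro concave_onD[OF ln_concave]) auto
    also have "(1 - m / L) *\<^sub>R 1 + (m / L) *\<^sub>R (1 + c * L) = 1 + m * c"
      using L by (simp add: field_simps)
    finally show ?thesis using m L False by (simp add: log_rate_def m_def[symmetric] field_simps)
  qed
  have "ln (1 + c * L) = (LINT x:{t..<u}|\<Delta>. ln (1 + c * L) / L)"
  proof -
    have "measure \<Delta> ({t..<u} \<inter> T) = L"
      using emeasure_Ico[of t u] assms L by (simp add: measure_def L_def)
    moreover have "(LINT x:{t..<u} \<inter> T|\<Delta>. ln (1 + c * L) / L) = measure \<Delta> ({t..<u} \<inter> T) * (ln (1 + c * L) / L)"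
      using borel_Int_in_sets[of "{t..<u}"] finite_emeasure_Ico[of t u]
      by (simp add: set_integral_const)
    ultimately show ?thesis using L by (simp add: set_integral_Int_T)
  qed
  also have "\<dots> \<le> (LINT x:{t..<u}|\<Delta>. log_rate c x)"
    using rate by (intro set_integral_mono set_integrable_const set_integrable_log_rate assms) auto
  finally have "decay c t u \<le> exp (- ln (1 + c * L))" by (simp add: decay_def)
  also have "\<dots> = 1 / (1 + c * L)" using p by (simp add: exp_minus inverse_eq_divide)
  finally show ?thesis by (simp add: L_def)
qed

text \<open>Since \<open>1 + \<mu> x * circle_dot T n c x = (1 + \<mu> x * c) ^ n\<close>, the
  operation \<ominus> produces the reciprocal power. This is a positive real number, where the
  principal logarithm is the real one.\<close>

lemma cylinder_circle_minus_dot: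
  assumes "0 \<le> c"
  shows "cylinder_transformation (\<mu> x) (circle_minus T (\<lambda>t. of_real (circle_dot T n c t)) x)
    = of_real (- real n * log_rate c x)"
proof (cases "\<mu> x = 0")
  case True
  then show ?thesis by (simp add: cylinder_transformation_def circle_minus_def circle_dot_def log_rate_def)
next
  case False
  then have m: "0 < \<mu> x" using graininess_nonneg[of x] by simp
  define q where "q = 1 + \<mu> x * c"
  have q: "0 < q" using assms m by (simp add: q_def add_pos_nonneg)
  have dot: "\<mu> x * circle_dot T n c x = q ^ n - 1" using m by (simp add: circle_dot_def q_def)
  have "1 + of_real (\<mu> x) * circle_minus T (\<lambda>t. of_real (circle_dot T n c t)) x
      = (of_real (1 - \<mu> x * circle_dot T n c x / (1 + \<mu> x * circle_dot T n c x)) :: complex)"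
    by (simp add: circle_minus_def)
  also have "\<dots> = of_real (inverse (q ^ n))"
    unfolding dot using q by (simp add: field_simps)
  finally have "cylinder_transformation (\<mu> x) (circle_minus T (\<lambda>t. of_real (circle_dot T n c t)) x)
      = Ln (of_real (inverse (q ^ n))) / of_real (\<mu> x)"
    using m by (simp add: cylinder_transformation_def)
  also have "Ln (of_real (inverse (q ^ n))) = of_real (ln (inverse (q ^ n)))"
    using q by (intro Ln_of_real) simp
  also have "ln (inverse (q ^ n)) = - (real n * ln q)" using q by (simp add: ln_inverse ln_realpow)
  finally show ?thesis using m by (simp add: log_rate_def q_def)
qed

lemma delta_exp_circle_minus_dot:
  assumes "0 \<le> c" "s \<le> t"
  shows "delta_exp T (circle_minus T (\<lambda>t. of_real (circle_dot T n c t))) t s = of_real (decay c s t ^ n)"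
proof -
  have "delta_integral T s t (\<lambda>x. cylinder_transformation (\<mu> x) (circle_minus T (\<lambda>t. of_real (circle_dot T n c t)) x))
      = (LINT x:{s..<t}|\<Delta>. complex_of_real (- real n * log_rate c x))"
    using assms by (simp add: delta_integral_def cylinder_circle_minus_dot)
  also have "\<dots> = of_real (LINT x:{s..<t}|\<Delta>. - real n * log_rate c x)"
    by (rule set_integral_complex_of_real)
  also have "(LINT x:{s..<t}|\<Delta>. - real n * log_rate c x) = real n * - (LINT x:{s..<t}|\<Delta>. log_rate c x)"
    by (subst set_integral_mult_right) simp
  finally show ?thesis
    by (simp only: delta_exp_def decay_def exp_of_nat_mult[symmetric] exp_of_real)
qed

subsection \<open>Moments against exponentials\<close>

abbreviation at_top_T :: "real filter" where "at_top_T \<equiv> inf at_top (principal T)"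

lemma at_top_T_neq_bot: "at_top_T \<noteq> bot"
proof
  assume "at_top_T = bot"
  then have "\<forall>\<^sub>F x in at_top_T. False" by simp
  then have "\<forall>\<^sub>F x in at_top. x \<notin> T" by (simp only: eventually_inf_principal) simp
  then obtain N where "\<And>x. N \<le> x \<Longrightarrow> x \<notin> T" by (auto simp: eventually_at_top_linorder)
  then show False using ex_gt[of N] by (meson less_imp_le)
qed

lemma eventually_at_top_T: "\<forall>\<^sub>F x in at_top_T. x \<in> T \<and> a \<le> x"
  unfolding eventually_inf_principal using eventually_ge_at_top[of a] by eventually_elim simp

lemma antimono_decay_forward_jump: "0 \<le> c \<Longrightarrow> antimono (\<lambda>x. decay c s (\<sigma> x))"
  using antimonoD[OF antimono_decay] monoD[OF mono_forward_jump] by (intro antimonoI) blast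

text \<open>Expanding the exponential turns the integral into a series in the moments, each of which
  tends to 0. Limit and sum commute because the partial moments are bounded uniformly in
  \<open>n\<close> and \<open>t\<close>.\<close>

lemma Laplace_weight_tendsto_0:
  fixes g :: "real \<Rightarrow> complex"
  assumes s: "s \<in> T" and c: "0 \<le> c" and C: "0 \<le> C"
    and g: "\<And>t. t \<in> T \<Longrightarrow> s \<le> t \<Longrightarrow> set_integrable \<Delta> {s..<t} g"
    and B: "\<And>t. t \<in> T \<Longrightarrow> s \<le> t \<Longrightarrow> norm (LINT x:{s..<t}|\<Delta>. g x) \<le> B"
    and moments: "\<And>n. ((\<lambda>t. LINT x:{s..<t}|\<Delta>. decay c s (\<sigma> x) ^ n *\<^sub>R g x) \<longlongrightarrow> 0) at_top_T"
  shows "((\<lambda>t. LINT x:{s..<t}|\<Delta>. (1 - exp (- (C * decay c s (\<sigma> x)))) *\<^sub>R g x) \<longlongrightarrow> 0) at_top_T"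
proof -
  define W where "W x = decay c s (\<sigma> x)" for x
  define I where "I n t = (LINT x:{s..<t}|\<Delta>. W x ^ n *\<^sub>R g x)" for n t
  \<comment> \<open>Coefficients of the power series of \<open>exp (- (C * w))\<close> in
    \<open>w\<close>.\<close>
  define q where "q n = inverse (fact n) * (- C) ^ n" for n
  have W: "0 < W x" "W x \<le> 1" for x using decay_pos decay_le_1[OF c] by (auto simp: W_def)
  have aW: "antimono W" unfolding W_def using c by (rule antimono_decay_forward_jump)
  have Wm [measurable]: "W \<in> borel_measurable borel" using aW by (rule borel_measurable_antimono)
  have Wn: "0 \<le> W x ^ n" "W x ^ n \<le> 1" for x n
    using W[of x] by (auto intro: power_le_one less_imp_le)
  have Wg: "set_integrable \<Delta> {s..<t} (\<lambda>x. W x ^ n *\<^sub>R g x)" if "t \<in> T" "s \<le> t" for t n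
    using Wn by (intro set_integrable_mult_bounded[OF g[OF that], of _ 1]) auto
  have qn: "\<bar>q n\<bar> = inverse (fact n) * C ^ n" for n
    using C by (simp add: q_def abs_mult power_abs)
  have sq: "summable (\<lambda>n. \<bar>q n\<bar>)" unfolding qn by (rule summable_exp)
  \<comment> \<open>Abel's inequality for the antimonotone weight \<open>W x ^ n\<close>, whose
    initial value is at most 1: the bound for \<open>g\<close> itself serves for every
    \<open>n\<close>.\<close>
  have I_bound: "norm (I n t) \<le> B" if t: "t \<in> T" "s \<le> t" for n t
  proof -
    have "norm (I n t) \<le> W s ^ n * B" unfolding I_def
    proof (rule norm_set_integral_antimono_le[OF s t])
      show "antimono (\<lambda>x. W x ^ n)"
        using antimonoD[OF aW] W by (intro antimonoI power_mono) (auto intro: less_imp_le)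
    qed (use W g B t in \<open>auto intro: less_imp_le\<close>)
    also have "\<dots> \<le> 1 * B" using Wn[of s n] B[OF s order_refl] norm_ge_zero order_trans
      by (intro mult_right_mono) blast+
    finally show ?thesis by simp
  qed
  \<comment> \<open>Up to a fixed \<open>t\<close> the function \<open>g\<close> is absolutely
    integrable, so the series may be integrated termwise with majorants
    \<open>\<bar>q n\<bar> * norm (g x)\<close>.\<close>
  have series: "(LINT x:{s..<t}|\<Delta>. exp (- (C * W x)) *\<^sub>R g x) = (\<Sum>n. q n *\<^sub>R I n t)"
    if t: "t \<in> T" "s \<le> t" for t
  proof -
    let ?f = "\<lambda>n x. indicator {s..<t} x *\<^sub>R (q n *\<^sub>R (W x ^ n *\<^sub>R g x))"
    have gn: "integrable \<Delta> (\<lambda>x. indicator {s..<t} x * norm (g x))"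
      using integrable_norm[OF g[OF t, unfolded set_integrable_def]] by simp
    have fi: "integrable \<Delta> (?f n)" for n
      using set_integrable_scaleR_right[OF Wg[OF t], of "q n" n] by (simp add: set_integrable_def)
    have fb: "norm (?f n x) \<le> \<bar>q n\<bar> * (indicator {s..<t} x * norm (g x))" for n x
    proof -
      have "W x ^ n * norm (g x) \<le> norm (g x)" by (intro mult_left_le_one_le Wn norm_ge_zero)
      from mult_left_mono[OF this, of "\<bar>q n\<bar>"] show ?thesis
        by (auto split: split_indicator simp: abs_mult abs_of_nonneg[OF Wn(1)] mult.assoc)
    qed
    have "(\<Sum>n. integral\<^sup>L \<Delta> (?f n)) = (LINT x|\<Delta>. (\<Sum>n. ?f n x))"
    proof (rule integral_suminf[symmetric, OF fi])
      show "AE x in \<Delta>. summable (\<lambda>n. norm (?f n x))"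
        by (intro AE_I2 summable_comparison_test'[OF summable_mult2[OF sq]]) (use fb in auto)
      show "summable (\<lambda>n. LINT x|\<Delta>. norm (?f n x))"
      proof (rule summable_comparison_test'[OF summable_mult2[OF sq]])
        fix n
        have "(LINT x|\<Delta>. norm (?f n x)) \<le> (LINT x|\<Delta>. \<bar>q n\<bar> * (indicator {s..<t} x * norm (g x)))"
          by (intro integral_mono integrable_norm fi integrable_mult_right gn fb)
        also have "\<dots> = \<bar>q n\<bar> * (LINT x|\<Delta>. indicator {s..<t} x * norm (g x))" by simp
        finally show "norm (LINT x|\<Delta>. norm (?f n x)) \<le> \<bar>q n\<bar> * (LINT x|\<Delta>. indicator {s..<t} x * norm (g x))"
          by simp
      qed
    qed
    also have "(\<lambda>x. \<Sum>n. ?f n x) = (\<lambda>x. indicator {s..<t} x *\<^sub>R (exp (- (C * W x)) *\<^sub>R g x))"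
    proof
      fix x
      have "(\<lambda>n. (- (C * W x)) ^ n /\<^sub>R fact n) sums exp (- (C * W x))" by (rule exp_converges)
      also have "(\<lambda>n. (- (C * W x)) ^ n /\<^sub>R fact n) = (\<lambda>n. q n * W x ^ n)"
        by (auto simp: q_def power_mult_distrib[symmetric])
      finally have "(\<lambda>n. indicator {s..<t} x *\<^sub>R ((q n * W x ^ n) *\<^sub>R g x)) sums
          (indicator {s..<t} x *\<^sub>R (exp (- (C * W x)) *\<^sub>R g x))"
        by (intro sums_scaleR_right sums_scaleR_left)
      then show "(\<Sum>n. ?f n x) = indicator {s..<t} x *\<^sub>R (exp (- (C * W x)) *\<^sub>R g x)"
        by (simp add: sums_iff)
    qed
    finally have "(LINT x:{s..<t}|\<Delta>. exp (- (C * W x)) *\<^sub>R g x) = (\<Sum>n. integral\<^sup>L \<Delta> (?f n))"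
      by (simp add: set_lebesgue_integral_def)
    also have "(\<lambda>n. integral\<^sup>L \<Delta> (?f n)) = (\<lambda>n. q n *\<^sub>R I n t)"
      unfolding I_def set_integral_scaleR_right[symmetric] by (simp add: set_lebesgue_integral_def)
    finally show ?thesis .
  qed
  \<comment> \<open>Tannery's theorem: the summable majorant \<open>\<bar>q n\<bar> * B\<close> is
    valid for all \<open>t\<close> in \<open>T\<close> from \<open>s\<close> on.\<close>
  have "((\<lambda>t. \<Sum>n. q n *\<^sub>R I n t) \<longlongrightarrow> 0) at_top_T"
  proof -
    have lim: "((\<lambda>t. q n *\<^sub>R I n t) \<longlongrightarrow> 0) at_top_T" for n
      using tendsto_scaleR[OF tendsto_const moments[of n], of "q n"] by (simp add: I_def W_def)
    have "\<forall>\<^sub>F t in at_top_T. \<forall>n. norm (q n *\<^sub>R I n t) \<le> \<bar>q n\<bar> * B"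
      using eventually_at_top_T[of s] by eventually_elim (auto intro!: mult_left_mono I_bound)
    then have "\<forall>\<^sub>F (n, t) in sequentially \<times>\<^sub>F at_top_T. norm (q n *\<^sub>R I n t) \<le> \<bar>q n\<bar> * B"
      unfolding eventually_prod_filter by (intro exI[of _ "\<lambda>_. True"] exI conjI) auto
    from tannerys_theorem[OF lim this summable_mult2[OF sq] at_top_T_neq_bot] show ?thesis by simp
  qed
  then have exp0: "((\<lambda>t. LINT x:{s..<t}|\<Delta>. exp (- (C * W x)) *\<^sub>R g x) \<longlongrightarrow> 0) at_top_T"
  proof (rule Lim_transform_eventually)
    show "\<forall>\<^sub>F t in at_top_T. (\<Sum>n. q n *\<^sub>R I n t) = (LINT x:{s..<t}|\<Delta>. exp (- (C * W x)) *\<^sub>R g x)"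
      using eventually_at_top_T[of s] by eventually_elim (simp add: series)
  qed
  \<comment> \<open>The constant 1 in the weight is accounted for by the moment with
    \<open>n = 0\<close>.\<close>
  have g0: "((\<lambda>t. LINT x:{s..<t}|\<Delta>. g x) \<longlongrightarrow> 0) at_top_T" using moments[of 0] by simp
  have "((\<lambda>t. (LINT x:{s..<t}|\<Delta>. g x) - (LINT x:{s..<t}|\<Delta>. exp (- (C * W x)) *\<^sub>R g x)) \<longlongrightarrow> 0 - 0) at_top_T"
    by (intro tendsto_diff g0 exp0)
  moreover have "\<forall>\<^sub>F t in at_top_T. (LINT x:{s..<t}|\<Delta>. g x) - (LINT x:{s..<t}|\<Delta>. exp (- (C * W x)) *\<^sub>R g x)
      = (LINT x:{s..<t}|\<Delta>. (1 - exp (- (C * W x))) *\<^sub>R g x)"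
    using eventually_at_top_T[of s]
  proof eventually_elim
    case (elim t)
    have "set_integrable \<Delta> {s..<t} (\<lambda>x. exp (- (C * W x)) *\<^sub>R g x)"
      using elim C W by (intro set_integrable_mult_bounded[OF g, of _ _ 1]) (auto simp: less_imp_le)
    then show ?case using elim g[of t]
      by (subst set_integral_diff(2)[symmetric]) (auto simp: algebra_simps)
  qed
  ultimately show ?thesis by (auto simp: W_def intro: Lim_transform_eventually)
qed

text \<open>The weighted improper integral is 0, so the integral up to \<open>t\<close> is minus the
  remaining tail, which Abel's inequality bounds by the weight at \<open>t\<close>. The factor
  \<open>2 * B\<close> arises because integrals of \<open>g\<close> starting at \<open>t\<close> are
  differences of two partial integrals starting at \<open>s\<close>.\<close>

lemma Laplace_weight_tail:
  fixes g :: "real \<Rightarrow> complex"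
  assumes s: "s \<in> T" and c: "0 \<le> c" and C: "0 \<le> C"
    and g: "\<And>t. t \<in> T \<Longrightarrow> s \<le> t \<Longrightarrow> set_integrable \<Delta> {s..<t} g"
    and B: "\<And>t. t \<in> T \<Longrightarrow> s \<le> t \<Longrightarrow> norm (LINT x:{s..<t}|\<Delta>. g x) \<le> B"
    and moments: "\<And>n. ((\<lambda>t. LINT x:{s..<t}|\<Delta>. decay c s (\<sigma> x) ^ n *\<^sub>R g x) \<longlongrightarrow> 0) at_top_T"
    and t: "t \<in> T" "s \<le> t"
  shows "norm (LINT x:{s..<t}|\<Delta>. (1 - exp (- (C * decay c s (\<sigma> x)))) *\<^sub>R g x)
    \<le> (1 - exp (- (C * decay c s (\<sigma> t)))) * (2 * B)"
proof -
  define h where "h x = 1 - exp (- (C * decay c s (\<sigma> x)))" for x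
  define J where "J u = (LINT x:{s..<u}|\<Delta>. h x *\<^sub>R g x)" for u
  have h: "0 \<le> h x" "h x \<le> 1" for x using C decay_pos by (auto simp: h_def less_imp_le)
  have ah: "antimono h"
    unfolding h_def using C antimonoD[OF antimono_decay_forward_jump[OF c]]
    by (intro antimonoI) (auto intro!: mult_left_mono)
  have hm: "h \<in> borel_measurable borel" using ah by (rule borel_measurable_antimono)
  have lim: "(J \<longlongrightarrow> 0) at_top_T"
    unfolding J_def h_def by (rule Laplace_weight_tendsto_0[OF s c C g B moments])
  have split: "{s..<u} = {s..<t} \<union> {t..<u}" if "t \<le> u" for u using that t by auto
  have tail: "norm (J t) \<le> norm (J u) + h t * (2 * B)" if u: "u \<in> T" "t \<le> u" for u
  proof -
    have su: "s \<le> u" using u t by simp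
    have gt: "set_integrable \<Delta> {t..<v} g" if "v \<in> T" "t \<le> v" for v
      using that t by (intro set_integrable_subset_borel[OF g[of v]]) auto
    have hi: "set_integrable \<Delta> A (\<lambda>x. h x *\<^sub>R g x)" if "set_integrable \<Delta> A g" for A
      using h by (intro set_integrable_mult_bounded[OF that hm, of 1]) auto
    have "J u = J t + (LINT x:{t..<u}|\<Delta>. h x *\<^sub>R g x)"
      unfolding J_def split[OF u(2)] using u t
      by (intro set_integral_Un hi g gt) auto
    moreover have "norm (LINT x:{t..<u}|\<Delta>. h x *\<^sub>R g x) \<le> h t * (2 * B)"
    proof (rule norm_set_integral_antimono_le[OF t(1) u ah h(1) gt[OF u]])
      fix v assume v: "v \<in> T" "t \<le> v"
      have "(LINT x:{s..<v}|\<Delta>. g x) = (LINT x:{s..<t}|\<Delta>. g x) + (LINT x:{t..<v}|\<Delta>. g x)"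
        unfolding split[OF v(2)] using v t by (intro set_integral_Un g gt) auto
      then show "norm (LINT x:{t..<v}|\<Delta>. g x) \<le> 2 * B"
        using B[OF v(1)] B[OF t] v t norm_triangle_ineq4[of "LINT x:{s..<v}|\<Delta>. g x" "LINT x:{s..<t}|\<Delta>. g x"]
        by simp
    qed
    ultimately show ?thesis
      using norm_triangle_ineq4[of "J u" "LINT x:{t..<u}|\<Delta>. h x *\<^sub>R g x"] by simp
  qed
  \<comment> \<open>Letting \<open>u\<close> tend to infinity in \<open>tail\<close> removes
    \<open>J u\<close>.\<close>
  have "((\<lambda>u. norm (J u) + h t * (2 * B)) \<longlongrightarrow> norm (0::complex) + h t * (2 * B)) at_top_T"
    by (intro tendsto_intros lim)
  then have "norm (J t) \<le> norm (0::complex) + h t * (2 * B)"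
  proof (rule tendsto_lowerbound[OF _ _ at_top_T_neq_bot])
    show "\<forall>\<^sub>F u in at_top_T. norm (J t) \<le> norm (J u) + h t * (2 * B)"
      using eventually_at_top_T[of t] by eventually_elim (use tail in auto)
  qed
  then show ?thesis by (simp add: J_def h_def)
qed

text \<open>Convergence bounds the partial integrals from some \<open>N\<close> on; the earlier ones
  are dominated by the integral of \<open>norm (g x)\<close> up to one point \<open>u\<close> beyond
  \<open>N\<close>.\<close>

lemma partial_integrals_bounded:
  fixes g :: "real \<Rightarrow> 'a::{banach, second_countable_topology}"
  assumes s: "s \<in> T"
    and g: "\<And>t. t \<in> T \<Longrightarrow> s \<le> t \<Longrightarrow> set_integrable \<Delta> {s..<t} g"
    and lim: "((\<lambda>t. LINT x:{s..<t}|\<Delta>. g x) \<longlongrightarrow> l) at_top_T"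
  obtains B where "\<And>t. t \<in> T \<Longrightarrow> s \<le> t \<Longrightarrow> norm (LINT x:{s..<t}|\<Delta>. g x) \<le> B"
proof -
  have "\<forall>\<^sub>F t in at_top_T. norm (LINT x:{s..<t}|\<Delta>. g x) < norm l + 1"
    by (rule order_tendstoD(2)[OF tendsto_norm[OF lim]]) simp
  then obtain N where N: "\<And>t. t \<in> T \<Longrightarrow> N \<le> t \<Longrightarrow> norm (LINT x:{s..<t}|\<Delta>. g x) < norm l + 1"
    by (auto simp: eventually_inf_principal eventually_at_top_linorder)
  obtain u where u: "u \<in> T" "max N s < u" using ex_gt by blast
  define K where "K = (LINT x:{s..<u}|\<Delta>. norm (g x))"
  have gn: "integrable \<Delta> (\<lambda>x. indicator {s..<t} x *\<^sub>R norm (g x))" if "t \<in> T" "s \<le> t" for t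
    using integrable_norm[OF g[OF that, unfolded set_integrable_def]] by simp
  have "norm (LINT x:{s..<t}|\<Delta>. g x) \<le> max (norm l + 1) K" if t: "t \<in> T" "s \<le> t" for t
  proof (cases "N \<le> t")
    case True then show ?thesis using N[OF t(1)] by force
  next
    case False
    have "norm (LINT x:{s..<t}|\<Delta>. g x) \<le> (LINT x|\<Delta>. norm (indicator {s..<t} x *\<^sub>R g x))"
      unfolding set_lebesgue_integral_def by (rule integral_norm_bound)
    also have "\<dots> \<le> K" unfolding K_def set_lebesgue_integral_def
      using g[OF t] gn[OF t] gn[OF u(1)] u False
      by (intro integral_mono) (auto simp: set_integrable_def split: split_indicator)
    finally show ?thesis by simp
  qed
  then show ?thesis by (rule that)
qed

text \<open>The scale \<open>C = sqrt c / decay c s t\<close> makes the weight \<open>1 - exp (- C * decay c s u)\<close> tend to the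
  indicator of \<open>{..t}\<close> as \<open>c \<rightarrow> \<infinity>\<close>; the factor \<open>sqrt c\<close> decides the borderline case \<open>u = t\<close>.\<close>

lemma Laplace_weight_tendsto_indicator:
  assumes \<zeta>: "\<And>k. 0 \<le> \<zeta> k" "filterlim \<zeta> at_top sequentially"
    and t: "t \<in> T" "s \<le> t" and u: "u \<in> T"
  shows "(\<lambda>k. 1 - exp (- (sqrt (\<zeta> k) / decay (\<zeta> k) s t * decay (\<zeta> k) s u))) \<longlonglongrightarrow> indicator {..t} u"
proof (cases "u \<le> t")
  case True
  have lim: "(\<lambda>k. 1 - exp (- sqrt (\<zeta> k))) \<longlonglongrightarrow> 1 - 0"
    by (intro tendsto_intros filterlim_compose[OF exp_at_bot]
        filterlim_compose[OF filterlim_uminus_at_bot_at_top] filterlim_compose[OF sqrt_at_top] \<zeta>)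
  have "(\<lambda>k. 1 - exp (- (sqrt (\<zeta> k) / decay (\<zeta> k) s t * decay (\<zeta> k) s u))) \<longlonglongrightarrow> 1"
  proof (rule tendsto_sandwich[OF always_eventually always_eventually, where f = "\<lambda>k. 1 - exp (- sqrt (\<zeta> k))" and h = "\<lambda>_. 1"])
    show "(\<lambda>k. 1 - exp (- sqrt (\<zeta> k))) \<longlonglongrightarrow> 1" using lim by simp
    show "\<forall>k. 1 - exp (- (sqrt (\<zeta> k) / decay (\<zeta> k) s t * decay (\<zeta> k) s u)) \<le> 1" by simp
    show "\<forall>k. 1 - exp (- sqrt (\<zeta> k)) \<le> 1 - exp (- (sqrt (\<zeta> k) / decay (\<zeta> k) s t * decay (\<zeta> k) s u))"
    proof
      fix k
      have "decay (\<zeta> k) s t \<le> decay (\<zeta> k) s u" using antimonoD[OF antimono_decay[OF \<zeta>(1)] True] .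
      then have "sqrt (\<zeta> k) * 1 \<le> sqrt (\<zeta> k) * (decay (\<zeta> k) s u / decay (\<zeta> k) s t)"
        using \<zeta>(1)[of k] decay_pos[of "\<zeta> k" s t] by (intro mult_left_mono) auto
      then show "1 - exp (- sqrt (\<zeta> k)) \<le> 1 - exp (- (sqrt (\<zeta> k) / decay (\<zeta> k) s t * decay (\<zeta> k) s u))"
        by simp
    qed
  qed simp
  then show ?thesis using True by simp
next
  case False
  then have ut: "0 < u - t" by simp
  \<comment> \<open>Beyond \<open>t\<close> the quotient of the decay factors is
    \<open>decay (\<zeta> k) t u\<close>, of order at most \<open>1 / \<zeta> k\<close> by
    \<open>decay_bound\<close>, which outweighs \<open>sqrt (\<zeta> k)\<close>.\<close>
  have "(\<lambda>k. 1 - exp (- (sqrt (\<zeta> k) / decay (\<zeta> k) s t * decay (\<zeta> k) s u))) \<longlonglongrightarrow> 0"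
  proof (rule tendsto_sandwich[OF always_eventually always_eventually, where f = "\<lambda>_. 0" and h = "\<lambda>k. sqrt (\<zeta> k) / (1 + \<zeta> k * (u - t))"])
    show "(\<lambda>k. sqrt (\<zeta> k) / (1 + \<zeta> k * (u - t))) \<longlonglongrightarrow> 0"
      by (rule filterlim_compose[OF sqrt_over_linear_tendsto_0[OF ut] \<zeta>(2)])
    show "\<forall>k. 0 \<le> 1 - exp (- (sqrt (\<zeta> k) / decay (\<zeta> k) s t * decay (\<zeta> k) s u))"
      using \<zeta>(1) less_imp_le[OF decay_pos] by (auto intro!: mult_nonneg_nonneg divide_nonneg_nonneg)
    show "\<forall>k. 1 - exp (- (sqrt (\<zeta> k) / decay (\<zeta> k) s t * decay (\<zeta> k) s u)) \<le> sqrt (\<zeta> k) / (1 + \<zeta> k * (u - t))"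
    proof
      fix k
      let ?x = "sqrt (\<zeta> k) / decay (\<zeta> k) s t * decay (\<zeta> k) s u"
      have "1 - exp (- ?x) \<le> ?x" using exp_ge_add_one_self[of "- ?x"] by simp
      also have "?x = sqrt (\<zeta> k) * decay (\<zeta> k) t u"
        using decay_split[OF \<zeta>(1) t(2), of u k] False decay_pos[of "\<zeta> k" s t] by simp
      also have "\<dots> \<le> sqrt (\<zeta> k) * (1 / (1 + \<zeta> k * (u - t)))"
        using False \<zeta>(1) t u by (intro mult_left_mono decay_bound) auto
      finally show "1 - exp (- ?x) \<le> sqrt (\<zeta> k) / (1 + \<zeta> k * (u - t))" by simp
    qed
  qed simp
  then show ?thesis using False by simp
qed

text \<open>Dominated convergence on an interval reaching beyond \<open>t\<close> sends the weighted
  integrals to the integral over \<open>\<sigma> x \<le> t\<close>, while the tail estimate sends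
  them to 0.\<close>

proposition integrals_eq_0_if_moments_eq_0:
  fixes g :: "real \<Rightarrow> complex"
  assumes s: "s \<in> T" and \<zeta>: "\<And>k. 0 \<le> \<zeta> k" "filterlim \<zeta> at_top sequentially"
    and g: "\<And>t. t \<in> T \<Longrightarrow> s \<le> t \<Longrightarrow> set_integrable \<Delta> {s..<t} g"
    and moments: "\<And>n k. ((\<lambda>t. LINT x:{s..<t}|\<Delta>. decay (\<zeta> k) s (\<sigma> x) ^ n *\<^sub>R g x) \<longlongrightarrow> 0) at_top_T"
    and t: "t \<in> T" "s \<le> t"
  shows "(LINT x:{s..<t}|\<Delta>. g x) = 0"
proof -
  have "((\<lambda>t. LINT x:{s..<t}|\<Delta>. g x) \<longlongrightarrow> 0) at_top_T" using moments[where n = 0] by simp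
  from partial_integrals_bounded[OF s g this] obtain B
    where B: "\<And>t. t \<in> T \<Longrightarrow> s \<le> t \<Longrightarrow> norm (LINT x:{s..<t}|\<Delta>. g x) \<le> B" by blast
  \<comment> \<open>The tail bound at \<open>t'\<close> tends to 0 because
    \<open>\<sigma> t' > t\<close>. At a right-dense \<open>t\<close> the weight would tend to 1
    instead.\<close>
  obtain t' where t': "t' \<in> T" "t < t'" using ex_gt by blast
  then have st': "s \<le> t'" using t by simp
  define C where "C k = sqrt (\<zeta> k) / decay (\<zeta> k) s t" for k
  have C: "0 \<le> C k" for k using \<zeta>(1)[of k] decay_pos[of "\<zeta> k" s t] by (simp add: C_def)
  define h where "h k x = 1 - exp (- (C k * decay (\<zeta> k) s (\<sigma> x)))" for k x
  have h: "0 \<le> h k x" "h k x \<le> 1" for k x using C decay_pos by (auto simp: h_def less_imp_le)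
  have hm: "h k \<in> borel_measurable borel" for k
    using borel_measurable_antimono[OF antimono_decay_forward_jump[OF \<zeta>(1)[of k]], of s]
    unfolding h_def by measurable
  have h_lim: "(\<lambda>k. h k x) \<longlonglongrightarrow> indicator {..t} (\<sigma> x)" for x
    unfolding h_def C_def by (rule Laplace_weight_tendsto_indicator[OF \<zeta> t forward_jump_mem])
  have gi: "integrable \<Delta> (\<lambda>x. indicator {s..<t'} x *\<^sub>R g x)"
    using g[OF t'(1) st'] by (simp add: set_integrable_def)
  have bi: "set_integrable \<Delta> {s..<t'} (\<lambda>x. indicator {..t} (\<sigma> x) *\<^sub>R g x)"
    by (intro set_integrable_mult_bounded[OF g[OF t'(1) st'], of _ 1]) (auto simp: indicator_def)
  have hi: "set_integrable \<Delta> {s..<t'} (\<lambda>x. h k x *\<^sub>R g x)" for k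
    using h by (intro set_integrable_mult_bounded[OF g[OF t'(1) st'] hm, where K = 1]) auto
  have "(\<lambda>k. LINT x:{s..<t'}|\<Delta>. h k x *\<^sub>R g x) \<longlonglongrightarrow> (LINT x:{s..<t'}|\<Delta>. indicator {..t} (\<sigma> x) *\<^sub>R g x)"
    unfolding set_lebesgue_integral_def
  proof (rule integral_dominated_convergence)
    show "integrable \<Delta> (\<lambda>x. norm (indicator {s..<t'} x *\<^sub>R g x))" by (rule integrable_norm[OF gi])
    show "AE x in \<Delta>. (\<lambda>k. indicator {s..<t'} x *\<^sub>R h k x *\<^sub>R g x)
        \<longlonglongrightarrow> indicator {s..<t'} x *\<^sub>R indicator {..t} (\<sigma> x) *\<^sub>R g x"
      by (intro AE_I2 tendsto_intros h_lim)
    show "AE x in \<Delta>. norm (indicator {s..<t'} x *\<^sub>R h k x *\<^sub>R g x) \<le> norm (indicator {s..<t'} x *\<^sub>R g x)" for k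
      using h by (intro AE_I2) (auto split: split_indicator intro!: mult_left_le_one_le)
  qed (use bi hi in \<open>auto simp: set_integrable_def\<close>)
  \<comment> \<open>\<open>B\<close> bounds partial integrals of \<open>g\<close> alone and is thus
    the same for all \<open>k\<close>.\<close>
  moreover have "(\<lambda>k. LINT x:{s..<t'}|\<Delta>. h k x *\<^sub>R g x) \<longlonglongrightarrow> 0"
  proof (rule Lim_null_comparison)
    show "\<forall>\<^sub>F k in sequentially. norm (LINT x:{s..<t'}|\<Delta>. h k x *\<^sub>R g x) \<le> h k t' * (2 * B)"
      unfolding h_def by (intro always_eventually allI Laplace_weight_tail[OF s \<zeta>(1) C g B moments t'(1) st'])
    have "\<not> \<sigma> t' \<le> t" using forward_jump_ge[of t'] t'(2) by simp
    then show "(\<lambda>k. h k t' * (2 * B)) \<longlonglongrightarrow> 0"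
      using tendsto_mult[OF h_lim[of t'] tendsto_const[of "2 * B"]] by simp
  qed
  ultimately have "(LINT x:{s..<t'}|\<Delta>. indicator {..t} (\<sigma> x) *\<^sub>R g x) = 0"
    by (rule LIMSEQ_unique)
  \<comment> \<open>On \<open>T\<close>, \<open>\<sigma> x \<le> t\<close> means
    \<open>x < t\<close>, except that \<open>x = t\<close> also qualifies when \<open>t\<close> is
    right-dense; then \<open>{t}\<close> is null.\<close>
  moreover have "(LINT x:{s..<t}|\<Delta>. g x) = (LINT x:{s..<t'}|\<Delta>. indicator {..t} (\<sigma> x) *\<^sub>R g x)"
    unfolding set_lebesgue_integral_def
  proof (rule integral_cong_AE)
    have "AE x in \<Delta>. \<not> (x = t \<and> \<sigma> t = t)"
    proof (cases "\<sigma> t = t")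
      case True
      from AE_not_in[OF right_dense_null[OF t(1) True]] show ?thesis by eventually_elim simp
    qed simp
    moreover have "AE x in \<Delta>. x \<in> T" by (intro AE_I2) simp
    ultimately show "AE x in \<Delta>. indicator {s..<t} x *\<^sub>R g x = indicator {s..<t'} x *\<^sub>R indicator {..t} (\<sigma> x) *\<^sub>R g x"
    proof eventually_elim
      case (elim x)
      consider "x < t" | "x = t" "t < \<sigma> t" | "t < x"
        using elim forward_jump_ge[of t] by fastforce
      then show ?case
        using forward_jump_le[OF t(1), of x] forward_jump_ge[of x] t'(2)
        by cases (auto simp: indicator_def)
    qed
  qed (use g[OF t] bi in \<open>auto simp: set_integrable_def\<close>)
  ultimately show ?thesis by simp
qed

end

section \<open>Transfer from Laplace transforms to moments\<close>

theorem theorem1: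
  fixes T :: "real set" and s :: real and f :: "real \<Rightarrow> complex"
    and \<zeta> :: "nat \<Rightarrow> real" and \<alpha> :: complex
  assumes "time_scale T" and "\<not> bdd_above T" and "s \<in> T"
    and "locally_delta_integrable T s f"
    and "\<And>k. 0 \<le> \<zeta> k" and "incseq \<zeta>" and "filterlim \<zeta> at_top sequentially"
    and "\<And>t. t \<in> T \<Longrightarrow> s \<le> t \<Longrightarrow>
           1 + \<alpha> * of_real (graininess T t) \<in> \<real> \<and> 0 < Re (1 + \<alpha> * of_real (graininess T t))"
    and "\<And>n k. laplace_exists T s
           (\<lambda>\<eta>. f \<eta> * delta_exp T (circle_minus T (\<lambda>t. of_real (circle_dot T n (\<zeta> k) t)))
                       (forward_jump T \<eta>) s) \<alpha>"
    and "\<And>n k. laplace T s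
           (\<lambda>\<eta>. f \<eta> * delta_exp T (circle_minus T (\<lambda>t. of_real (circle_dot T n (\<zeta> k) t)))
                       (forward_jump T \<eta>) s) \<alpha> = 0"
  shows "delta_null_function T s f"
proof -
  interpret unbounded_time_scale T by unfold_locales fact+
  define E where "E x = delta_exp T (circle_minus T (\<lambda>_. \<alpha>)) (\<sigma> x) s" for x
  define g where "g x = f x * E x" for x
  define F where "F n k x = laplace_integrand T s
           (\<lambda>\<eta>. f \<eta> * delta_exp T (circle_minus T (\<lambda>t. of_real (circle_dot T n (\<zeta> k) t))) (\<sigma> \<eta>) s) \<alpha> x" for n k x
  have F: "F n k x = decay (\<zeta> k) s (\<sigma> x) ^ n *\<^sub>R g x" if "s \<le> x" for n k x
  proof -
    have "s \<le> \<sigma> x" using that forward_jump_ge[of x] by simp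
    then show ?thesis
      using assms(5) by (simp add: F_def laplace_integrand_def g_def E_def delta_exp_circle_minus_dot scaleR_conv_of_real)
  qed
  \<comment> \<open>Limits along the nontrivial filter \<open>at_top_T\<close> are unique, so the
    description operator in \<open>laplace\<close> yields the actual improper integral.\<close>
  have improper: "has_improper_delta_integral T s (F n k) 0" for n k
  proof -
    obtain I where I: "has_improper_delta_integral T s (F n k) I"
      using assms(9)[of n k] unfolding laplace_exists_def F_def by blast
    have "(THE I. has_improper_delta_integral T s (F n k) I) = I"
    proof (rule the_equality)
      show "has_improper_delta_integral T s (F n k) I" by (rule I)
    next
      fix J assume "has_improper_delta_integral T s (F n k) J"
      with I show "J = I"
        by (auto simp: has_improper_delta_integral_def dest: tendsto_unique[OF at_top_T_neq_bot, rotated])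
    qed
    then show ?thesis using I assms(10)[of n k] by (simp add: laplace_def F_def[abs_def])
  qed
  \<comment> \<open>For \<open>n = 0\<close> the Laplace integrand agrees with \<open>g\<close> from
    \<open>s\<close> on, and its local integrability is part of the existence of the
    transform.\<close>
  have g: "set_integrable \<Delta> {s..<t} g" if t: "t \<in> T" "s \<le> t" for t
  proof -
    have "set_integrable \<Delta> {s..t} (F 0 0)"
      using improper[of 0 0] t assms(3) by (auto simp: has_improper_delta_integral_def locally_delta_integrable_def)
    then have "set_integrable \<Delta> {s..<t} (F 0 0)" by (rule set_integrable_subset_borel) auto
    then show ?thesis by (rule set_integrable_cong[THEN iffD1, rotated 3]) (auto simp: F)
  qed
  have moments: "((\<lambda>t. LINT x:{s..<t}|\<Delta>. decay (\<zeta> k) s (\<sigma> x) ^ n *\<^sub>R g x) \<longlongrightarrow> 0) at_top_T" for n k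
  proof (rule Lim_transform_eventually)
    show "((\<lambda>t. delta_integral T s t (F n k)) \<longlongrightarrow> 0) at_top_T"
      using improper by (simp add: has_improper_delta_integral_def)
    show "\<forall>\<^sub>F t in at_top_T. delta_integral T s t (F n k) = (LINT x:{s..<t}|\<Delta>. decay (\<zeta> k) s (\<sigma> x) ^ n *\<^sub>R g x)"
      using eventually_at_top_T[of s]
      by eventually_elim
        (auto simp: delta_integral_def set_lebesgue_integral_def F split: split_indicator
          intro!: Bochner_Integration.integral_cong)
  qed
  have g0: "(LINT x:{s..<t}|\<Delta>. g x) = 0" if "t \<in> T" "s \<le> t" for t
    using integrals_eq_0_if_moments_eq_0[OF assms(3) assms(5,7) g moments that] .
  show ?thesis unfolding delta_null_function_def
  proof (intro ballI impI)
    fix t assume t: "t \<in> T" "s \<le> t"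
    have "AE x in \<Delta>. x \<in> {s..<t} \<longrightarrow> g x = 0"
      by (rule AE_eq_0_if_integrals_eq_0[OF assms(3) t g[OF t] g0])
    \<comment> \<open>\<open>E x\<close> is a value of the complex exponential, hence nonzero, so
      \<open>g x = 0\<close> forces \<open>f x = 0\<close>.\<close>
    then have "AE x in \<Delta>. indicator {s..<t} x *\<^sub>R f x = 0"
      by eventually_elim (auto simp: g_def E_def delta_exp_def split: split_indicator)
    then have "(LINT x:{s..<t}|\<Delta>. f x) = 0"
      unfolding set_lebesgue_integral_def by (rule integral_eq_zero_AE)
    then show "delta_integral T s t f = 0" using t by (simp add: delta_integral_def)
  qed
qed

end
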